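(* Given any quasisymmetric homeomorphism $\phi$ of $\mathbb{RP}^1$, let $w$ be the width of the convex hull of the graph of $\phi$ in $\partial_\infty\mathrm{AdS}^3$. Then $$\tan w\leq\sinh\left(\frac{\|\phi\|_{cr}}{2}\right)\,.$$
   Context: Anti-de Sitter space. $\mathbb{R}^{2,2}$ is $\mathbb{R}^4$ with $\langle x,y\rangle=x^1y^1+x^2y^2-x^3y^3-x^4y^4$; $\mathrm{AdS}^3=\mathrm{P}(\{\langle x,x\rangle<0\})\subset\mathbb{RP}^3$, with the time-oriented Lorentzian metric of constant curvature $-1$ induced from its double cover $\{x:\langle x,x\rangle=-1\}$. A totally geodesic spacelike plane is $p^\perp$ with $\langle p,p\rangle<0$; it is isometric to $\mathbb{H}^2$. The length of a timelike curve $\gamma$ is $\int\sqrt{-\langle\dot\gamma,\dot\gamma\rangle}\,dt$. Boundary at infinity. $\partial_\infty\mathrm{AdS}^3=\mathrm{P}(\{\langle x,x\rangle=0\})$ is a doubly ruled quadric (left and right ruling). A spacelike plane $P$ meets each line of either ruling exactly once at infinity; fixing $P$ and identifying $\partial_\infty P=\partial\mathbb{H}^2=\mathbb{RP}^1$, one identifies $\partial_\infty\mathrm{AdS}^3$ with $\mathbb{RP}^1\times\mathbb{RP}^1$ by $\xi\mapsto(\pi_l(\xi),\pi_r(\xi))$, the projections to $\partial_\infty P$ along the left and right rulings. The graph $gr(\phi)$ is thus a curve in $\partial_\infty\mathrm{AdS}^3$. Width. For $\Gamma=gr(\phi)$, the convex hull $\mathcal{CH}(\Gamma)$ is the intersection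 of the half-spaces containing $\Gamma$ bounded by planes $P$ with $\partial_\infty P\cap\Gamma=\emptyset$. The width $w$ is the supremum of the lengths of timelike geodesic segments contained in $\mathcal{CH}(\Gamma)$ ($0$ if there are none). Cross-ratio norm. For points of $\mathbb{RP}^1=\mathbb{R}\cup\{\infty\}$, $cr(z_1,z_2,z_3,z_4)=\frac{(z_4-z_1)(z_3-z_2)}{(z_2-z_1)(z_3-z_4)}$. For an orientation-preserving homeomorphism $\phi$ of $\mathbb{RP}^1$, $\|\phi\|_{cr}=\sup_{cr(Q)=-1}\big|\ln|cr(\phi(Q))|\big|$, the supremum being over quadruples $Q$ of points with $cr(Q)=-1$. $\phi$ is quasisymmetric if it is orientation-preserving with $\|\phi\|_{cr}<+\infty$. *)

theory Defs
  imports "HOL-Analysis.Analysis" "HOL-Library.Option_ord"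
begin

section \<open>The real projective line and quasisymmetric homeomorphisms\<close>

text \<open>
  The real projective line is \<open>real option\<close>, with \<open>None\<close> for \<open>\<infinity>\<close>, topologised as the
  one-point compactification of the reals.
\<close>

type_synonym rp1 = "real option"

abbreviation RP1 :: "rp1 topology" where
  "RP1 \<equiv> Alexandroff_compactification euclideanreal"

text \<open>
  The linear order on \<open>real option\<close> puts \<open>\<infinity>\<close> at the bottom. Only the induced cyclic order is
  used, and that would be the same with \<open>\<infinity>\<close> at the top.
\<close>

definition cyclic :: "rp1 \<Rightarrow> rp1 \<Rightarrow> rp1 \<Rightarrow> bool" where
  "cyclic x y z \<longleftrightarrow> x < y \<and> y < z \<or> y < z \<and> z < x \<or> z < x \<and> x < y"

definition orientation_preserving_homeo :: "(rp1 \<Rightarrow> rp1) \<Rightarrow> bool" where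
  "orientation_preserving_homeo \<phi> \<longleftrightarrow>
     homeomorphic_map RP1 RP1 \<phi> \<and> (\<forall>x y z. cyclic x y z \<longrightarrow> cyclic (\<phi> x) (\<phi> y) (\<phi> z))"

text \<open>
  The difference \<open>x - y\<close> in homogeneous coordinates: the determinant of the representatives
  \<open>(x, 1)\<close>, \<open>(y, 1)\<close>, where \<open>\<infinity>\<close> is represented by \<open>(1, 0)\<close>. In the cross-ratio each point occurs
  once above and once below, so the choice of representatives cancels and the usual
  conventions for \<open>\<infinity>\<close> result.
\<close>

fun hdiff :: "rp1 \<Rightarrow> rp1 \<Rightarrow> real" where
  "hdiff (Some x) (Some y) = x - y"
| "hdiff None (Some y) = 1"
| "hdiff (Some x) None = -1"
| "hdiff None None = 0"

definition cr :: "rp1 \<Rightarrow> rp1 \<Rightarrow> rp1 \<Rightarrow> rp1 \<Rightarrow> real" where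
  "cr z1 z2 z3 z4 = (hdiff z4 z1 * hdiff z3 z2) / (hdiff z2 z1 * hdiff z3 z4)"

text \<open>
  \<open>cr z1 z2 z3 z4 = -1\<close> forces the four points to be distinct: \<open>cr\<close> is \<open>0\<close> if the numerator or
  the denominator vanishes (division by zero included), and \<open>1\<close> if it is defined and
  \<open>z1 = z3\<close> or \<open>z2 = z4\<close>. So for injective \<open>\<phi>\<close> the logarithm below has a positive argument.
\<close>

definition cr_norm :: "(rp1 \<Rightarrow> rp1) \<Rightarrow> ereal" where
  "cr_norm \<phi> = (SUP (z1, z2, z3, z4) \<in> {(z1, z2, z3, z4). cr z1 z2 z3 z4 = -1}.
                  ereal \<bar>ln \<bar>cr (\<phi> z1) (\<phi> z2) (\<phi> z3) (\<phi> z4)\<bar>\<bar>)"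

definition quasisymmetric :: "(rp1 \<Rightarrow> rp1) \<Rightarrow> bool" where
  "quasisymmetric \<phi> \<longleftrightarrow> orientation_preserving_homeo \<phi> \<and> cr_norm \<phi> < \<infinity>"


section \<open>Anti-de Sitter space and its boundary\<close>

definition form22 :: "real^4 \<Rightarrow> real^4 \<Rightarrow> real" where
  "form22 x y = x$1 * y$1 + x$2 * y$2 - x$3 * y$3 - x$4 * y$4"

text \<open>Points of projective 3-space are the lines through the origin of \<open>real^4\<close>.\<close>

type_synonym rp3 = "(real^4) set"

definition proj :: "real^4 \<Rightarrow> rp3" where
  "proj x = span {x}"

definition AdS3 :: "rp3 set" where
  "AdS3 = proj ` {x. form22 x x < 0}"

definition bdry_AdS3 :: "rp3 set" where
  "bdry_AdS3 = proj ` {x. x \<noteq> 0 \<and> form22 x x = 0}"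

text \<open>The trace of \<open>plane p\<close> on AdS is spacelike iff \<open>form22 p p < 0\<close>.\<close>

definition plane :: "real^4 \<Rightarrow> rp3 set" where
  "plane p = {l. \<exists>x. x \<noteq> 0 \<and> l = proj x \<and> form22 x p = 0}"

text \<open>
  The two rulings of the boundary quadric, each line being given by the totally isotropic
  linear plane over it. With \<open>z = x1 + i x2\<close> and \<open>w = x3 + i x4\<close> the quadric is \<open>|z| = |w|\<close>, and it
  is ruled by the families \<open>w = e^(i a) z\<close> and \<open>w = e^(i a) cnj z\<close>. Which one is called left is a
  choice of orientation.
\<close>

definition left_ruling :: "(real^4) set set" where
  "left_ruling = range (\<lambda>a. {x. Complex (x$3) (x$4) = cis a * Complex (x$1) (x$2)})"

definition right_ruling :: "(real^4) set set" where
  "right_ruling = range (\<lambda>a. {x. Complex (x$3) (x$4) = cis a * cnj (Complex (x$1) (x$2))})"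

text \<open>
  The fixed spacelike plane is \<open>P = plane (axis 4 1)\<close>, that is \<open>x4 = 0\<close>. It is the hyperboloid model
  of the hyperbolic plane, isometric to the upper half-plane; on the boundary the isometry
  identifies \<open>t\<close> with \<open>[1 - t^2 : 2t : 1 + t^2 : 0]\<close>.
\<close>

fun bdry_P :: "rp1 \<Rightarrow> rp3" where
  "bdry_P (Some t) = proj (vector [1 - t\<^sup>2, 2 * t, 1 + t\<^sup>2, 0])"
| "bdry_P None = proj (vector [-1, 0, 1, 0])"

definition proj_l :: "rp3 \<Rightarrow> rp1" where
  "proj_l \<xi> = (THE t. \<exists>L\<in>left_ruling. \<xi> \<subseteq> L \<and> bdry_P t \<subseteq> L)"

definition proj_r :: "rp3 \<Rightarrow> rp1" where
  "proj_r \<xi> = (THE t. \<exists>L\<in>right_ruling. \<xi> \<subseteq> L \<and> bdry_P t \<subseteq> L)"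

definition gr :: "(rp1 \<Rightarrow> rp1) \<Rightarrow> rp3 set" where
  "gr \<phi> = {\<xi> \<in> bdry_AdS3. proj_r \<xi> = \<phi> (proj_l \<xi>)}"


section \<open>Convex hull and width\<close>

text \<open>
  A single plane does not separate projective space (nor does a spacelike plane separate AdS):
  half-spaces make sense in an affine chart, the complement of a plane \<open>plane p\<^sub>0\<close>.
  In that chart, normalised by \<open>form22 x p\<^sub>0 = 1\<close>, the two half-spaces bounded by \<open>plane p\<close> are
  \<open>half_space p\<^sub>0 p\<close> and \<open>half_space p\<^sub>0 (- p)\<close>.
\<close>

definition half_space :: "real^4 \<Rightarrow> real^4 \<Rightarrow> rp3 set" where
  "half_space p\<^sub>0 p = {l. \<exists>x. l = proj x \<and> form22 x p\<^sub>0 = 1 \<and> form22 x p \<ge> 0}"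

text \<open>
  The convex hull in AdS of a curve \<open>\<Gamma>\<close> at infinity. The charts are those containing \<open>\<Gamma>\<close>; for
  connected \<open>\<Gamma>\<close> each of them yields the same set, so quantifying over all of them fixes no choice.
  The planes are not required to be spacelike: for the graph of an orientation-preserving
  homeomorphism, every plane disjoint from it is.
\<close>

definition avoids :: "rp3 set \<Rightarrow> real^4 \<Rightarrow> bool" where
  "avoids \<Gamma> p \<longleftrightarrow> p \<noteq> 0 \<and> plane p \<inter> \<Gamma> = {}"

definition CH :: "rp3 set \<Rightarrow> rp3 set" where
  "CH \<Gamma> = {l \<in> AdS3. \<forall>p\<^sub>0 p. avoids \<Gamma> p\<^sub>0 \<and> avoids \<Gamma> p \<and> \<Gamma> \<subseteq> half_space p\<^sub>0 p
                        \<longrightarrow> l \<in> half_space p\<^sub>0 p}"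

text \<open>
  Geodesic segments of AdS are described by their lifts to the double cover
  \<open>form22 x x = -1\<close>. The normal space of this quadric at \<open>x\<close> is spanned by \<open>x\<close>, so the
  geodesic equation says that the acceleration is a multiple of the position.
\<close>

definition timelike_geodesic_segment :: "real \<Rightarrow> real \<Rightarrow> (real \<Rightarrow> real^4) \<Rightarrow> bool" where
  "timelike_geodesic_segment a b \<gamma> \<longleftrightarrow> a < b \<and>
     (\<exists>\<gamma>' \<gamma>''. \<forall>t\<in>{a..b}.
        (\<gamma> has_vector_derivative \<gamma>' t) (at t within {a..b}) \<and>
        (\<gamma>' has_vector_derivative \<gamma>'' t) (at t within {a..b}) \<and>
        form22 (\<gamma> t) (\<gamma> t) = -1 \<and> form22 (\<gamma>' t) (\<gamma>' t) < 0 \<and> \<gamma>'' t \<in> span {\<gamma> t})"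

definition timelike_length :: "real \<Rightarrow> real \<Rightarrow> (real \<Rightarrow> real^4) \<Rightarrow> real" where
  "timelike_length a b \<gamma> = integral {a..b}
     (\<lambda>t. let v = vector_derivative \<gamma> (at t within {a..b}) in sqrt (- form22 v v))"

text \<open>
  An upper bound on the tangent of the width has content only for widths below \<open>pi / 2\<close>, where the
  tangent becomes infinite (in HOL, \<open>tan (pi / 2) = 0\<close>); it has to be stated with \<open>width \<Gamma> < pi / 2\<close>.
\<close>

definition width :: "rp3 set \<Rightarrow> ereal" where
  "width \<Gamma> = Sup (insert 0 {ereal (timelike_length a b \<gamma>) | a b \<gamma>.
                    timelike_geodesic_segment a b \<gamma> \<and> (\<forall>t\<in>{a..b}. proj (\<gamma> t) \<in> CH \<Gamma>)})"

end

theory Submission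
  imports Defs "HOL-Real_Asymp.Real_Asymp"
begin

text \<open>
  Let \<open>\<langle>x, y\<rangle> = - form22 x y\<close> (\<open>tform\<close> below), so that AdS consists of the lines with \<open>\<langle>x, x\<rangle> > 0\<close>, and let
  \<open>N\<close> be the cross-ratio norm of \<open>\<phi>\<close>. Points at infinity are pure tensors \<open>u \<otimes> v\<close> of
  vectors of the plane, with \<open>\<langle>u \<otimes> v, u' \<otimes> v'\<rangle> = 2 (u \<and> u') (v \<and> v')\<close>, and the rulings fix one of
  the factors; the graph of \<open>\<phi>\<close> is the curve \<open>u(t) \<otimes> u(\<phi> t)\<close>. Because \<open>\<phi>\<close> preserves the cyclic
  order, the signs of these tensors can be chosen such that any two distinct ones have positive product.
  Hence the hull \<open>H\<close> of the curve lies in a cone on which \<open>\<langle>x, y\<rangle> \<ge> 0\<close>. On a timelike geodesic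
  segment of length \<open>L\<close> with end points \<open>x\<close>, \<open>y\<close> one has \<open>\<langle>x, y\<rangle> = cos L\<close>, if
  \<open>\<langle>x, x\<rangle> = \<langle>y, y\<rangle> = 1\<close>, so the proposition follows from
  \<open>\<langle>x, x\<rangle> \<langle>y, y\<rangle> \<le> cosh\<^sup>2 (N/2) \<langle>x, y\<rangle>\<^sup>2\<close>  for all \<open>x, y\<close> in \<open>H\<close>,
  which says \<open>1 / cos L \<le> cosh (N/2)\<close>, that is \<open>tan L \<le> sinh (N/2)\<close>.

  This inequality is first shown for \<open>x\<close> on a segment between two points of the curve that lie in
  a spacelike support plane \<open>P\<close> of the curve (\<open>edge_bound\<close>). In coordinates where the two points
  are \<open>0\<close> and \<open>\<infinity>\<close> and \<open>P\<close> is the plane of the identity, \<open>\<phi>\<close> fixes \<open>0\<close> and \<open>\<infinity>\<close> and, say,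
  \<open>\<phi>(t) \<ge> t\<close>. The quadruple \<open>0, t, \<infinity>, -t\<close> is harmonic, so \<open>\<phi>(t) / \<bar>\<phi>(-t)\<bar>\<close> lies between
  \<open>exp (- N)\<close> and \<open>exp N\<close>, and together with the support condition this gives
  \<open>t \<le> \<phi>(t) \<le> exp N * t\<close> for \<open>t > 0\<close> and \<open>exp (- N) * \<bar>t\<bar> \<le> \<bar>\<phi>(t)\<bar> \<le> \<bar>t\<bar>\<close> for \<open>t < 0\<close>. What remains is an
  elementary inequality about sums over points of such a double wedge (\<open>wedge_sum_bound\<close>).

  The general case is reduced to this one (\<open>hull_bound\<close>). Suppose that the inequality fails. For fixed
  \<open>y\<close> the quotient \<open>\<langle>x, x\<rangle> / \<langle>x, y\<rangle>\<^sup>2\<close> is maximal at some \<open>x\<close> in the compact \<open>H\<close>, and stationarity there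
  produces a spacelike support plane \<open>P\<close> through \<open>x\<close>; then, for this \<open>x\<close>, a maximal \<open>y\<close> has a
  support plane \<open>Q\<close>, which is moreover orthogonal to the geodesic from \<open>x\<close> to \<open>y\<close>. So \<open>x\<close> and \<open>y\<close> lie
  in ideal triangles of \<open>P\<close> and \<open>Q\<close> (or on edges, and then the first case applies). Moving
  both points simultaneously in a common direction, tangent to \<open>P\<close> and \<open>Q\<close> and orthogonal to
  \<open>x\<close> and \<open>y\<close>, only increases the violation, and eventually one of the points reaches an edge of
  its triangle, where the first case gives a contradiction.
\<close>

section \<open>The ambient form and isotropic vectors\<close>

definition tform :: "real^4 \<Rightarrow> real^4 \<Rightarrow> real" where
  "tform x y = - form22 x y"

lemma tform_eq: "tform x y = x$3 * y$3 + x$4 * y$4 - x$1 * y$1 - x$2 * y$2"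
  by (simp add: tform_def form22_def)

lemma bilinear_tform: "bilinear tform"
  by (auto simp: bilinear_def linear_iff tform_eq algebra_simps)

lemma tform_commute: "tform x y = tform y x"
  by (simp add: tform_eq)

lemmas tform_add_left = bilinear_ladd[OF bilinear_tform]
  and tform_add_right = bilinear_radd[OF bilinear_tform]
  and tform_diff_left = bilinear_lsub[OF bilinear_tform]
  and tform_diff_right = bilinear_rsub[OF bilinear_tform]
  and tform_neg_left = bilinear_lneg[OF bilinear_tform]
  and tform_neg_right = bilinear_rneg[OF bilinear_tform]
  and tform_zero_left = bilinear_lzero[OF bilinear_tform]
  and tform_zero_right = bilinear_rzero[OF bilinear_tform]

lemma tform_scaleR_left: "tform (c *\<^sub>R x) y = c * tform x y"
  by (simp add: tform_eq algebra_simps)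

lemma tform_scaleR_right: "tform x (c *\<^sub>R y) = c * tform x y"
  by (simp add: tform_eq algebra_simps)

lemmas tform_simps = tform_add_left tform_add_right tform_diff_left tform_diff_right
  tform_neg_left tform_neg_right tform_zero_left tform_zero_right
  tform_scaleR_left tform_scaleR_right

lemma tform_sum_left: "tform (\<Sum>i\<in>I. f i) y = (\<Sum>i\<in>I. tform (f i) y)"
  using linear_sum[of "\<lambda>x. tform x y"] bilinear_tform by (auto simp: bilinear_def)

lemma tform_sum_right: "tform y (\<Sum>i\<in>I. f i) = (\<Sum>i\<in>I. tform y (f i))"
  using tform_sum_left[of f I y] by (simp add: tform_commute)

definition wedge :: "real \<times> real \<Rightarrow> real \<times> real \<Rightarrow> real" where
  "wedge u v = fst u * snd v - snd u * fst v"

text \<open>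
  The tensor product of two vectors of the plane, in the identification of \<open>real^4\<close> with two by two
  matrices for which the form is the polarised determinant. A homogeneous coordinate is the pair
  \<open>(x, 1)\<close> or \<open>(1, 0)\<close>, as in \<open>hdiff\<close>.
\<close>

definition tens :: "real \<times> real \<Rightarrow> real \<times> real \<Rightarrow> real^4" where
  "tens u v = vector [snd u * snd v - fst u * fst v, fst u * snd v + snd u * fst v,
                      snd u * snd v + fst u * fst v, snd u * fst v - fst u * snd v]"

lemma vector_4_nth [simp]:
  "(vector [a, b, c, d] :: real^4) $ 1 = a" "(vector [a, b, c, d] :: real^4) $ 2 = b"
  "(vector [a, b, c, d] :: real^4) $ 3 = c" "(vector [a, b, c, d] :: real^4) $ 4 = d"
  by (simp_all add: vector_def)

lemma tens_nth:
  "tens u v $ 1 = snd u * snd v - fst u * fst v" "tens u v $ 2 = fst u * snd v + snd u * fst v"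
  "tens u v $ 3 = snd u * snd v + fst u * fst v" "tens u v $ 4 = snd u * fst v - fst u * snd v"
  by (simp_all add: tens_def)

lemma tform_tens: "tform (tens u v) (tens u' v') = 2 * wedge u u' * wedge v v'"
  by (simp add: tform_eq tens_nth wedge_def algebra_simps)

fun hvec :: "rp1 \<Rightarrow> real \<times> real" where
  "hvec (Some x) = (x, 1)"
| "hvec None = (1, 0)"

lemma wedge_hvec: "wedge (hvec s) (hvec t) = hdiff s t"
  by (cases s; cases t) (simp_all add: wedge_def)

lemma hdiff_swap: "hdiff t s = - hdiff s t"
  by (cases s; cases t) simp_all

lemma hdiff_eq_0_iff: "hdiff s t = 0 \<longleftrightarrow> s = t"
  by (cases s; cases t) auto

lemma hdiff_self [simp]: "hdiff t t = 0"
  by (simp add: hdiff_eq_0_iff)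

lemma ex_hvec:
  assumes "v \<noteq> 0"
  obtains c t where "c \<noteq> 0" "v = c *\<^sub>R hvec t"
proof (cases "snd v = 0")
  case True
  then show ?thesis using assms that[of "fst v" None] by (auto simp: prod_eq_iff)
next
  case False
  then show ?thesis using that[of "snd v" "Some (fst v / snd v)"] by (auto simp: prod_eq_iff)
qed

definition gtens :: "(rp1 \<Rightarrow> rp1) \<Rightarrow> rp1 \<Rightarrow> real^4" where
  "gtens \<phi> t = tens (hvec t) (hvec (\<phi> t))"

lemma tform_gtens: "tform (gtens \<phi> s) (gtens \<phi> t) = 2 * hdiff s t * hdiff (\<phi> s) (\<phi> t)"
  by (simp add: gtens_def tform_tens wedge_hvec)

text \<open>
  Multilinear expansion with respect to the parameters \<open>r\<close>, \<open>s\<close>: the identity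
  \<open>(r \<and> s) t = (t \<and> s) r + (r \<and> t) s\<close> is applied in both tensor factors.
\<close>

lemma gtens_expand:
  "(hdiff r s * hdiff (\<phi> r) (\<phi> s)) *\<^sub>R gtens \<phi> t =
     (hdiff t s * hdiff (\<phi> t) (\<phi> s)) *\<^sub>R gtens \<phi> r
   + (hdiff t s * hdiff (\<phi> r) (\<phi> t)) *\<^sub>R tens (hvec r) (hvec (\<phi> s))
   + (hdiff r t * hdiff (\<phi> t) (\<phi> s)) *\<^sub>R tens (hvec s) (hvec (\<phi> r))
   + (hdiff r t * hdiff (\<phi> r) (\<phi> t)) *\<^sub>R gtens \<phi> s"
proof -
  have pl: "hdiff r s *\<^sub>R hvec t = hdiff t s *\<^sub>R hvec r + hdiff r t *\<^sub>R hvec s" for r s t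
    by (cases r; cases s; cases t) (simp_all add: algebra_simps)
  have sc: "(a * b) *\<^sub>R tens u v = tens (a *\<^sub>R u) (b *\<^sub>R v)" for a b u v
    by (simp add: vec_eq_iff forall_4 tens_nth algebra_simps)
  have ad: "tens (u + u') (v + v') = tens u v + tens u v' + tens u' v + tens u' v'" for u u' v v'
    by (simp add: vec_eq_iff forall_4 tens_nth algebra_simps)
  show ?thesis
    by (simp only: gtens_def sc pl[of r s t] pl[of "\<phi> r" "\<phi> s" "\<phi> t"] ad)
qed

text \<open>
  If \<open>t\<close> has homogeneous coordinates \<open>(x : y)\<close> with respect to \<open>r\<close> and \<open>s\<close>, then its harmonic conjugate
  has the coordinates \<open>(x : - y)\<close>. The factor \<open>\<rho>\<close> comes from the normalisation of representatives.
\<close>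

lemma ex_harmonic_conjugate:
  assumes "r \<noteq> s" "t \<noteq> r" "t \<noteq> s"
  obtains t' \<rho> where "\<rho> \<noteq> 0" "hdiff t' s = \<rho> * hdiff t s" "hdiff r t' = - \<rho> * hdiff r t"
    "cr r t s t' = -1"
proof -
  define v where "v = hdiff t s *\<^sub>R hvec r - hdiff r t *\<^sub>R hvec s"
  have w: "wedge v (hvec s) = hdiff t s * hdiff r s" "wedge (hvec r) v = - hdiff r t * hdiff r s"
    by (simp_all add: v_def wedge_def algebra_simps flip: wedge_hvec)
  have nz: "hdiff r s \<noteq> 0" "hdiff t s \<noteq> 0" "hdiff r t \<noteq> 0"
    using assms by (auto simp: hdiff_eq_0_iff)
  have "v \<noteq> 0"
    using w(1) nz by (auto simp: wedge_def)
  then obtain c t' where c: "c \<noteq> 0" "v = c *\<^sub>R hvec t'" by (rule ex_hvec)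
  have 1: "c * hdiff t' s = hdiff t s * hdiff r s" "c * hdiff r t' = - hdiff r t * hdiff r s"
    using w c by (simp_all add: wedge_def algebra_simps flip: wedge_hvec)
  then have 2: "hdiff t' s = hdiff r s / c * hdiff t s" "hdiff r t' = - (hdiff r s / c) * hdiff r t"
    using c(1) by (simp_all add: field_simps)
  show ?thesis
  proof (rule that[OF _ 2])
    show "hdiff r s / c \<noteq> 0" using nz c by simp
    show "cr r t s t' = -1"
      using nz c(1) 2 by (simp add: cr_def hdiff_swap[of t' r] hdiff_swap[of s t] hdiff_swap[of t r] hdiff_swap[of s t'])
  qed
qed

section \<open>Orthogonal directions and first variations\<close>

definition flip :: "real^4 \<Rightarrow> real^4" where "flip x = vector [- (x$1), - (x$2), x$3, x$4]"

lemma tform_flip: "tform x y = flip x \<bullet> y"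
  by (simp add: tform_eq flip_def inner_vec_def sum_4)

lemma flip_eq_0: "flip x = 0 \<longleftrightarrow> x = 0"
  by (auto simp: flip_def vec_eq_iff forall_4)

lemma ex_tform_orthogonal:
  obtains z where "z \<noteq> 0" "tform x z = 0" "tform y z = 0" "tform p z = 0"
proof -
  have "dim {flip x, flip y, flip p} \<le> card {flip x, flip y, flip p}"
    by (rule dim_le_card[OF span_superset]) simp
  also have "\<dots> \<le> 3" by (simp add: card_insert_if)
  also have "3 < DIM(real^4)" by simp
  finally have "dim {flip x, flip y, flip p} < DIM(real^4)" .
  then obtain z where z: "z \<noteq> 0" "\<forall>y \<in> span {flip x, flip y, flip p}. orthogonal z y"
    by (rule orthogonal_to_subspace_exists) (metis that)
  have "orthogonal z (flip x)" "orthogonal z (flip y)" "orthogonal z (flip p)"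
    using z(2) by (auto intro: span_base)
  then show ?thesis
    by (intro that[OF z(1)]) (simp_all add: tform_flip orthogonal_def inner_commute[of z])
qed

text \<open>
  The form has signature (2,2), and the two timelike vectors span a plane on which it is definite, so
  it has the opposite sign on the orthogonal complement. Concretely, the timelike plane
  projects isomorphically to the last two coordinates, so subtracting from \<open>z\<close> an element of that plane
  makes these coordinates vanish.
\<close>

lemma tform_neg_orthogonal:
  assumes x: "tform x x = 1" and y: "tform y y = 1" and c: "\<bar>tform x y\<bar> < 1"
    and z: "z \<noteq> 0" "tform x z = 0" "tform y z = 0"
  shows "tform z z < 0"
proof -
  define c where "c = tform x y"
  have quad: "a\<^sup>2 + 2 * c * a * b + b\<^sup>2 \<ge> 0 \<and> (a\<^sup>2 + 2 * c * a * b + b\<^sup>2 = 0 \<longrightarrow> a = 0 \<and> b = 0)" for a b :: real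
  proof -
    have eq: "a\<^sup>2 + 2 * c * a * b + b\<^sup>2 = (a + c * b)\<^sup>2 + (1 - c\<^sup>2) * b\<^sup>2"
      by (simp add: power2_eq_square algebra_simps)
    have "1 - c\<^sup>2 > 0" using c by (simp add: c_def abs_square_less_1)
    then have nn: "(1 - c\<^sup>2) * b\<^sup>2 \<ge> 0" "(1 - c\<^sup>2) * b\<^sup>2 = 0 \<longleftrightarrow> b = 0" by auto
    show ?thesis unfolding eq
    proof (intro conjI impI)
      show "0 \<le> (a + c * b)\<^sup>2 + (1 - c\<^sup>2) * b\<^sup>2" using nn(1) by simp
      assume 0: "(a + c * b)\<^sup>2 + (1 - c\<^sup>2) * b\<^sup>2 = 0"
      then have "(1 - c\<^sup>2) * b\<^sup>2 = 0" using nn(1) zero_le_power2[of "a + c * b"] by linarith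
      then show "b = 0" using nn(2) by simp
      with 0 show "a = 0" by simp
    qed
  qed
  have comb: "tform (a *\<^sub>R x + b *\<^sub>R y) (a *\<^sub>R x + b *\<^sub>R y) = a\<^sup>2 + 2 * c * a * b + b\<^sup>2" for a b
    using x y by (simp add: tform_simps c_def tform_commute[of y x] power2_eq_square algebra_simps)
  have neg: "tform v v \<le> 0 \<and> (tform v v = 0 \<longrightarrow> v = 0)" if "v$3 = 0" "v$4 = 0" for v
  proof -
    have eq: "tform v v = - (v$1 * v$1 + v$2 * v$2)" using that by (simp add: tform_eq)
    show ?thesis
    proof (intro conjI impI)
      show "tform v v \<le> 0" unfolding eq using sum_squares_ge_zero[of "v$1" "v$2"] by linarith
      assume "tform v v = 0"
      then have "v$1 * v$1 + v$2 * v$2 = 0" unfolding eq by linarith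
      then have "v$1 = 0" "v$2 = 0" by (simp_all only: sum_squares_eq_zero_iff)
      then show "v = 0" using that by (simp add: vec_eq_iff forall_4)
    qed
  qed
  define \<delta> where "\<delta> = x$3 * y$4 - x$4 * y$3"
  \<comment> \<open>If the projections of \<open>x\<close> and \<open>y\<close> to the last two
    coordinates were dependent, a combination of \<open>x\<close> and \<open>y\<close> would have last
    coordinates zero, hence nonpositive square.\<close>
  have "\<delta> \<noteq> 0"
  proof
    assume \<delta>: "\<delta> = 0"
    have "tform (y$4 *\<^sub>R x + (- x$4) *\<^sub>R y) (y$4 *\<^sub>R x + (- x$4) *\<^sub>R y) \<le> 0"
      using neg \<delta> by (simp add: \<delta>_def mult.commute)
    then have 4: "x$4 = 0"
      unfolding comb using quad[of "y$4" "- x$4"] by (metis antisym neg_equal_0_iff_equal)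
    have "tform (y$3 *\<^sub>R x + (- x$3) *\<^sub>R y) (y$3 *\<^sub>R x + (- x$3) *\<^sub>R y) \<le> 0"
      using neg \<delta> by (simp add: \<delta>_def mult.commute)
    then have 3: "x$3 = 0"
      unfolding comb using quad[of "y$3" "- x$3"] by (metis antisym neg_equal_0_iff_equal)
    show False using neg[OF 3 4] x by simp
  qed
  define a where "a = (z$3 * y$4 - z$4 * y$3) / \<delta>"
  define b where "b = (x$3 * z$4 - x$4 * z$3) / \<delta>"
  define v where "v = z - (a *\<^sub>R x + b *\<^sub>R y)"
  have ab: "a * \<delta> = z$3 * y$4 - z$4 * y$3" "b * \<delta> = x$3 * z$4 - x$4 * z$3"
    using \<open>\<delta> \<noteq> 0\<close> by (simp_all add: a_def b_def)
  have "\<delta> * v$3 = \<delta> * z$3 - (a * \<delta>) * x$3 - (b * \<delta>) * y$3"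
    "\<delta> * v$4 = \<delta> * z$4 - (a * \<delta>) * x$4 - (b * \<delta>) * y$4"
    by (simp_all add: v_def algebra_simps)
  then have "\<delta> * v$3 = 0" "\<delta> * v$4 = 0" unfolding ab by (simp_all add: \<delta>_def algebra_simps)
  then have "v$3 = 0" "v$4 = 0" using \<open>\<delta> \<noteq> 0\<close> by simp_all
  note v = neg[OF this]
  have "tform v v = tform z z + tform (a *\<^sub>R x + b *\<^sub>R y) (a *\<^sub>R x + b *\<^sub>R y)"
    using z(2,3) by (simp add: v_def tform_simps tform_commute[of z x] tform_commute[of z y] algebra_simps)
  then have e: "tform v v = tform z z + (a\<^sup>2 + 2 * c * a * b + b\<^sup>2)" unfolding comb .
  show ?thesis
  proof (rule ccontr)
    assume "\<not> tform z z < 0"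
    then have "tform v v = 0" "a\<^sup>2 + 2 * c * a * b + b\<^sup>2 = 0"
      using e conjunct1[OF v] conjunct1[OF quad[of a b]] by linarith+
    then have "v = 0" "a = 0 \<and> b = 0"
      using conjunct2[OF v] conjunct2[OF quad[of a b]] by blast+
    then show False using z(1) by (simp add: v_def)
  qed
qed

text \<open>
  A ray that starts in the orthant and has a decreasing coordinate leaves the orthant through one of its
  faces. The pairs are (starting value, velocity) of the coordinates.
\<close>

lemma exit_time:
  fixes P :: "(real \<times> real) set"
  assumes fin: "finite P" and nn: "\<And>a z. (a, z) \<in> P \<Longrightarrow> a \<ge> 0" and neg: "(a0, z0) \<in> P" "z0 < 0"
  obtains s where "s \<ge> 0" "\<And>a z. (a, z) \<in> P \<Longrightarrow> a + s * z \<ge> 0" "\<exists>(a, z) \<in> P. a + s * z = 0"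
proof -
  define T where "T = (\<lambda>q. - fst q / snd q) ` {q \<in> P. snd q < 0}"
  have T: "finite T" "T \<noteq> {}" using fin neg by (auto simp: T_def)
  define s where "s = Min T"
  have "s \<in> T" using T unfolding s_def by (rule Min_in)
  then obtain a1 z1 where 1: "(a1, z1) \<in> P" "z1 < 0" "s = - a1 / z1" by (auto simp: T_def)
  have s0: "s \<ge> 0" using 1 nn[OF 1(1)] by (simp add: divide_nonneg_neg)
  show ?thesis
  proof (rule that[OF s0])
    fix a z assume az: "(a, z) \<in> P"
    show "a + s * z \<ge> 0"
    proof (cases "z < 0")
      case True
      then have "- a / z \<in> T" using az unfolding T_def by (intro image_eqI[of _ _ "(a, z)"]) auto
      then have "s \<le> - a / z" using T(1) unfolding s_def by (simp add: Min_le)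
      then show ?thesis using True by (simp add: field_simps)
    next
      case False
      then show ?thesis using s0 nn[OF az] by simp
    qed
  next
    show "\<exists>(a, z) \<in> P. a + s * z = 0"
      using 1 by (intro bexI[of _ "(a1, z1)"]) auto
  qed
qed

text \<open>
  The variational inequality at a maximum, in the form in which it is met when one moves from the
  maximiser towards another point of a convex set.
\<close>

lemma first_order_condition:
  fixes b c :: real
  assumes "\<And>t. 0 < t \<Longrightarrow> t \<le> 1 \<Longrightarrow> t * b + t\<^sup>2 * c \<le> 0"
  shows "b \<le> 0"
proof (rule ccontr)
  assume b: "\<not> b \<le> 0"
  define d where "d = \<bar>c\<bar> + 1"
  have d: "d > 0" by (simp add: d_def)
  define t where "t = min 1 (b / (2 * d))"
  have t: "0 < t" "t \<le> 1" using b d by (auto simp: t_def)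
  have "t * \<bar>c\<bar> \<le> t * d" using t by (simp add: d_def)
  also have "\<dots> \<le> b / (2 * d) * d" using d by (intro mult_right_mono) (auto simp: t_def)
  also have "\<dots> = b / 2" using d by simp
  finally have "b + t * c > 0"
    using b mult_left_mono[OF abs_ge_minus_self[of c], of t] t by simp
  then have "t * (b + t * c) > 0" using t by simp
  then show False using assms[OF t] by (simp add: power2_eq_square algebra_simps)
qed

section \<open>Reduction to the edges of support planes\<close>

definition nonneg_comb :: "(real^4) set \<Rightarrow> (real^4) set" where
  "nonneg_comb K = {x. \<exists>S b. finite S \<and> S \<subseteq> K \<and> (\<forall>v\<in>S. b v \<ge> 0) \<and> x = (\<Sum>v\<in>S. b v *\<^sub>R v)}"

lemma convex_hull_subset_nonneg_comb: "convex hull K \<subseteq> nonneg_comb K"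
  by (auto simp: convex_hull_explicit nonneg_comb_def)

lemma nonneg_comb_tform_nonneg:
  assumes "x \<in> nonneg_comb K" "\<And>v. v \<in> K \<Longrightarrow> tform p v \<ge> 0"
  shows "tform p x \<ge> 0"
  using assms
  by (auto simp: nonneg_comb_def tform_sum_right tform_simps subset_iff intro!: sum_nonneg mult_nonneg_nonneg)

lemma nonneg_comb_scaleR:
  assumes "x \<in> nonneg_comb K" "c \<ge> 0"
  shows "c *\<^sub>R x \<in> nonneg_comb K"
proof -
  obtain S b where "finite S" "S \<subseteq> K" "\<forall>v\<in>S. b v \<ge> 0" "x = (\<Sum>v\<in>S. b v *\<^sub>R v)"
    using assms(1) by (auto simp: nonneg_comb_def)
  with assms(2) show ?thesis
    by (auto simp: nonneg_comb_def scaleR_right.sum intro!: exI[of _ S] exI[of _ "\<lambda>v. c * b v"])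
qed

lemma nonneg_comb_3:
  assumes "s1 \<in> K" "s2 \<in> K" "s3 \<in> K" "s1 \<noteq> s2" "s1 \<noteq> s3" "s2 \<noteq> s3" "a1 \<ge> 0" "a2 \<ge> 0" "a3 \<ge> 0"
  shows "a1 *\<^sub>R s1 + a2 *\<^sub>R s2 + a3 *\<^sub>R s3 \<in> nonneg_comb K"
  unfolding nonneg_comb_def mem_Collect_eq
  using assms
  by (intro exI[of _ "{s1, s2, s3}"] exI[of _ "\<lambda>v. if v = s1 then a1 else if v = s2 then a2 else a3"])
     (auto simp: add.assoc)

text \<open>
  An abstract version of the lifted graph: a compact set of null vectors, any two of which
  are joined by a spacelike geodesic, normalised by a
  linear functional. The hypothesis \<open>edge\<close> is the inequality to
  be extended to the whole hull, for points on a chord that lies in a spacelike support plane.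
\<close>

locale null_curve =
  fixes K :: "(real^4) set" and p0 :: "real^4" and C :: real
  assumes compact_K: "compact K"
    and null: "v \<in> K \<Longrightarrow> tform v v = 0"
    and pos: "v \<in> K \<Longrightarrow> w \<in> K \<Longrightarrow> v \<noteq> w \<Longrightarrow> tform v w > 0"
    and norm1: "v \<in> K \<Longrightarrow> tform p0 v = 1"
    and C: "C \<ge> 1"
    and edge: "\<lbrakk>tform p p > 0; \<forall>v\<in>K. tform p v \<ge> 0; v1 \<in> K; v2 \<in> K; v1 \<noteq> v2;
      tform p v1 = 0; tform p v2 = 0; a1 \<ge> 0; a2 \<ge> 0; x = a1 *\<^sub>R v1 + a2 *\<^sub>R v2; y \<in> nonneg_comb K\<rbrakk> \<Longrightarrow>
      tform x x * tform y y \<le> C * (tform x y)\<^sup>2"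
begin

lemma tform_K_nonneg: "v \<in> K \<Longrightarrow> w \<in> K \<Longrightarrow> tform v w \<ge> 0"
  using null[of v] pos[of v w] by (cases "v = w") auto

lemma tform_comb_nonneg:
  assumes "x \<in> nonneg_comb K" "y \<in> nonneg_comb K"
  shows "tform x y \<ge> 0"
  by (intro nonneg_comb_tform_nonneg[OF assms(2)])
     (auto simp: tform_commute[of x] intro!: nonneg_comb_tform_nonneg[OF assms(1)] tform_K_nonneg)

text \<open>
  A product with a point of the curve could vanish only if \<open>y\<close> were a multiple of that point, and then
  \<open>y\<close> would be null.
\<close>

lemma tform_hull_pos:
  assumes x: "x \<in> convex hull K" and y: "y \<in> convex hull K" "tform y y > 0"
  shows "tform y x > 0"
proof -
  obtain S b where S: "finite S" "S \<subseteq> K" "\<forall>v\<in>S. b v \<ge> 0" "y = (\<Sum>v\<in>S. b v *\<^sub>R v)"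
    using y(1) by (auto simp: convex_hull_explicit)
  have "K \<subseteq> {x. tform y x > 0}"
  proof safe
    fix v assume v: "v \<in> K"
    have eq: "tform y v = (\<Sum>w\<in>S. b w * tform w v)"
      by (simp add: S(4) tform_sum_left tform_simps)
    have nn: "b w * tform w v \<ge> 0" if "w \<in> S" for w
      using that S v tform_K_nonneg by (auto intro!: mult_nonneg_nonneg)
    show "tform y v > 0"
    proof (rule ccontr)
      assume "\<not> tform y v > 0"
      then have "(\<Sum>w\<in>S. b w * tform w v) = 0"
        using nn sum_nonneg[of S "\<lambda>w. b w * tform w v"] unfolding eq by force
      then have z: "\<forall>w\<in>S. b w * tform w v = 0"
        using sum_nonneg_eq_0_iff[OF S(1), of "\<lambda>w. b w * tform w v"] nn by auto
      have "b w *\<^sub>R w = (if w = v then b v else 0) *\<^sub>R v" if "w \<in> S" for w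
        using z that pos[of w v] S(2) v by fastforce
      then have "y = (\<Sum>w\<in>S. (if w = v then b v else 0) *\<^sub>R v)"
        unfolding S(4) by (intro sum.cong) auto
      then have "y = (\<Sum>w\<in>S. if w = v then b v else 0) *\<^sub>R v" by (simp add: scaleR_left.sum)
      then have "tform y y = 0" using null[OF v] by (metis mult_zero_right tform_scaleR_left tform_scaleR_right)
      then show False using y(2) by simp
    qed
  qed
  moreover have "convex {x. tform y x > 0}"
    by (auto simp: tform_flip convex_halfspace_gt)
  ultimately show ?thesis using x hull_minimal[of K "{x. tform y x > 0}" convex] by blast
qed

text \<open>
  For fixed \<open>y\<close>, the quotient \<open>f x = \<langle>x, x\<rangle> / \<langle>y, x\<rangle>\<^sup>2\<close> attains a maximum on the compact hull. Its first
  variation says that the functional of \<open>p = k y - x\<close>, for a suitable \<open>k\<close>, is nonnegative on the curve and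
  zero at the maximiser \<open>x\<close>. The plane is spacelike because
  \<open>\<langle>p, p\<rangle> = f x \<langle>x, y\<rangle>\<^sup>2 (f x \<langle>y, y\<rangle> - 1)\<close>, and the last factor is positive when the inequality
  is violated. That \<open>p\<close> lies in the span of \<open>x\<close> and \<open>y\<close> means that the plane is orthogonal to the geodesic through them.
\<close>

lemma ex_support_plane:
  assumes y: "y \<in> convex hull K" "tform y y > 0" and x0: "x0 \<in> convex hull K"
    and viol: "C * (tform x0 y)\<^sup>2 < tform x0 x0 * tform y y"
  obtains x k p where "x \<in> convex hull K" "C * (tform x y)\<^sup>2 < tform x x * tform y y"
    "p = k *\<^sub>R y - x" "tform p p > 0" "\<forall>v\<in>K. tform p v \<ge> 0" "tform p x = 0"
proof -
  let ?H = "convex hull K"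
  have py: "tform y x > 0" if "x \<in> ?H" for x using tform_hull_pos that y by blast
  define f where "f x = tform x x / (tform y x)\<^sup>2" for x
  have ct: "continuous_on ?H (\<lambda>x. tform (g x) (h x))" if "continuous_on ?H g" "continuous_on ?H h" for g h
    unfolding tform_eq by (intro continuous_intros that)
  have "continuous_on ?H f" unfolding f_def
    by (intro continuous_intros ct) (use py in force)
  moreover have "compact ?H" using compact_K by (rule compact_convex_hull)
  ultimately obtain x where x: "x \<in> ?H" "\<And>u. u \<in> ?H \<Longrightarrow> f u \<le> f x"
    using continuous_attains_sup[of ?H f] x0 by blast
  define m where "m = f x"
  define n where "n = tform y x"
  have n: "n > 0" using py x(1) by (simp add: n_def)
  have xx: "tform x x = m * n\<^sup>2" using n by (simp add: m_def f_def n_def)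
  have "C < f x0 * tform y y"
    using viol py[OF x0] by (simp add: f_def pos_less_divide_eq tform_commute[of y x0])
  also have "\<dots> \<le> m * tform y y" unfolding m_def using x(2)[OF x0] y by (intro mult_right_mono) auto
  finally have my: "C < m * tform y y" .
  have m: "m > 0" using my C y(2) by (smt (verit) mult_nonpos_nonneg)
  have viol': "C * (tform x y)\<^sup>2 < tform x x * tform y y"
  proof -
    have "C * n\<^sup>2 < m * tform y y * n\<^sup>2" using my n by simp
    then show ?thesis by (simp add: xx n_def tform_commute[of x y] mult_ac)
  qed
  define p where "p = (m * n) *\<^sub>R y - x"
  have px: "tform p x = 0" by (simp add: p_def tform_simps xx n_def[symmetric] power2_eq_square)
  have "tform p p = m * n\<^sup>2 * (m * tform y y - 1)"
    by (simp add: p_def tform_simps xx tform_commute[of x y] n_def[symmetric] power2_eq_square algebra_simps)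
  then have pp: "tform p p > 0" using m n my C by simp
  have pv: "\<forall>v\<in>K. tform p v \<ge> 0"
  proof
    fix v assume v: "v \<in> K"
    define d where "d = v - x"
    have "2 * (tform x d - m * n * tform y d) \<le> 0"
    proof (rule first_order_condition)
      fix t :: real assume t: "0 < t" "t \<le> 1"
      have u: "x + t *\<^sub>R d \<in> ?H"
      proof -
        have "x + t *\<^sub>R d = (1 - t) *\<^sub>R x + t *\<^sub>R v" by (simp add: d_def algebra_simps)
        then show ?thesis using convexD_alt[OF convex_convex_hull x(1) hull_inc[OF v]] t by simp
      qed
      have "f (x + t *\<^sub>R d) \<le> m" using x(2)[OF u] by (simp add: m_def)
      then have "tform (x + t *\<^sub>R d) (x + t *\<^sub>R d) \<le> m * (tform y (x + t *\<^sub>R d))\<^sup>2"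
        using py[OF u] by (simp add: f_def pos_divide_le_eq)
      then show "t * (2 * (tform x d - m * n * tform y d)) + t\<^sup>2 * (tform d d - m * (tform y d)\<^sup>2) \<le> 0"
        by (simp add: tform_simps xx tform_commute[of d x] n_def[symmetric] power2_eq_square algebra_simps)
    qed
    moreover have "tform p v = - (tform x d - m * n * tform y d)"
      using px by (simp add: p_def d_def tform_simps algebra_simps)
    ultimately show "tform p v \<ge> 0" by simp
  qed
  show ?thesis using that[OF x(1) viol' p_def pp pv px] .
qed



text \<open>
  A point of the hull in a support plane is a combination of points of the curve in this plane, and by
  Caratheodory's theorem three of them suffice: the normalisation cuts out a two-dimensional affine
  subspace of the linear hyperplane.
\<close>

lemma face_decomposition:
  assumes x: "x \<in> convex hull K" "tform x x > 0"
    and p: "\<forall>v\<in>K. tform p v \<ge> 0" "tform p x = 0" "p \<noteq> 0"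
  obtains (segment) v1 v2 a1 a2 where "v1 \<in> K" "v2 \<in> K" "v1 \<noteq> v2" "tform p v1 = 0" "tform p v2 = 0"
      "a1 \<ge> 0" "a2 \<ge> 0" "x = a1 *\<^sub>R v1 + a2 *\<^sub>R v2"
    | (triangle) v1 v2 v3 a1 a2 a3 where "v1 \<in> K" "v2 \<in> K" "v3 \<in> K" "v1 \<noteq> v2" "v1 \<noteq> v3" "v2 \<noteq> v3"
      "tform p v1 = 0" "tform p v2 = 0" "tform p v3 = 0"
      "a1 \<ge> 0" "a2 \<ge> 0" "a3 \<ge> 0" "x = a1 *\<^sub>R v1 + a2 *\<^sub>R v2 + a3 *\<^sub>R v3"
proof -
  define W where "W = {v \<in> K. tform p v = 0}"
  have "x \<in> convex hull W"
  proof -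
    obtain S b where S: "finite S" "S \<subseteq> K" "\<forall>v\<in>S. b v \<ge> 0" "sum b S = 1" "(\<Sum>v\<in>S. b v *\<^sub>R v) = x"
      using x(1) by (auto simp: convex_hull_explicit)
    have nn: "b v * tform p v \<ge> 0" if "v \<in> S" for v
      using that S p(1) by (auto intro!: mult_nonneg_nonneg)
    have "(\<Sum>v\<in>S. b v * tform p v) = 0"
      using p(2) by (simp add: S(5)[symmetric] tform_sum_right tform_simps)
    then have z: "\<forall>v\<in>S. b v * tform p v = 0"
      using sum_nonneg_eq_0_iff[OF S(1), of "\<lambda>v. b v * tform p v"] nn by auto
    define S' where "S' = {v \<in> S. b v \<noteq> 0}"
    have "S' \<subseteq> W" "finite S'" using z S by (auto simp: S'_def W_def)
    moreover have "sum b S' = 1"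
      unfolding S(4)[symmetric] by (rule sum.mono_neutral_left) (auto simp: S'_def S(1))
    moreover have "(\<Sum>v\<in>S'. b v *\<^sub>R v) = x"
      unfolding S(5)[symmetric] by (rule sum.mono_neutral_left) (auto simp: S'_def S(1))
    moreover have "\<forall>v\<in>S'. b v \<ge> 0" using S(3) by (simp add: S'_def)
    ultimately show ?thesis
      unfolding convex_hull_explicit mem_Collect_eq by (intro exI[of _ S'] exI[of _ b] conjI)
  qed
  have "aff_dim W \<le> 2"
  proof -
    have "affine {v. tform p0 v = 1}"
      by (auto simp: affine_def tform_simps simp flip: distrib_right)
    moreover have "W \<subseteq> {v. tform p0 v = 1}" using norm1 by (auto simp: W_def)
    ultimately have "affine hull W \<subseteq> {v. tform p0 v = 1}" by (simp add: hull_minimal)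
    then have 0: "0 \<notin> affine hull W" by (auto simp: tform_simps)
    have "aff_dim W + 1 = aff_dim (insert 0 W)" using 0 by (simp add: aff_dim_insert)
    also have "\<dots> = int (dim (insert 0 W))" by (rule aff_dim_zero) (simp add: hull_inc)
    also have "dim (insert 0 W) \<le> dim {v. flip p \<bullet> v = 0}"
      by (rule dim_subset) (auto simp: W_def tform_flip)
    also have "dim {v. flip p \<bullet> v = 0} = 3" using p(3) by (simp add: dim_hyperplane flip_eq_0)
    finally show ?thesis by simp
  qed
  then obtain T where T: "finite T" "T \<subseteq> W" "card T \<le> 3" "x \<in> convex hull T"
    using \<open>x \<in> convex hull W\<close> unfolding caratheodory_aff_dim[of W] by auto
  consider "card T = 0" | "card T = 1" | "card T = 2" | "card T = 3" using T(3) by linarith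
  then show ?thesis
  proof cases
    case 1
    then show ?thesis using T by simp
  next
    case 2
    then obtain v where "T = {v}" by (auto simp: card_1_singleton_iff)
    then have "x = v" "v \<in> K" using T by (auto simp: W_def)
    then show ?thesis using x(2) null by simp
  next
    case 3
    then obtain v1 v2 where v: "T = {v1, v2}" "v1 \<noteq> v2" by (auto simp: card_2_iff)
    then obtain a1 a2 where "a1 \<ge> 0" "a2 \<ge> 0" "x = a1 *\<^sub>R v1 + a2 *\<^sub>R v2"
      using T(4) by (auto simp: convex_hull_2)
    then show ?thesis using v T(2) by (intro segment[of v1 v2 a1 a2]) (auto simp: W_def)
  next
    case 4
    then obtain v1 v2 v3 where v: "T = {v1, v2, v3}" "v1 \<noteq> v2" "v2 \<noteq> v3" "v1 \<noteq> v3"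
      by (auto simp: card_3_iff)
    then obtain a1 a2 a3 where "a1 \<ge> 0" "a2 \<ge> 0" "a3 \<ge> 0" "x = a1 *\<^sub>R v1 + a2 *\<^sub>R v2 + a3 *\<^sub>R v3"
      using T(4) by (auto simp: convex_hull_3)
    then show ?thesis using v T(2) by (intro triangle[of v1 v2 v3 a1 a2 a3]) (auto simp: W_def)
  qed
qed

text \<open>
  Three distinct points are linearly independent, since their Gram matrix has zero diagonal
  and positive entries elsewhere, hence positive determinant.
\<close>

lemma triangle_spans_plane:
  assumes v: "v1 \<in> K" "v2 \<in> K" "v3 \<in> K" "v1 \<noteq> v2" "v1 \<noteq> v3" "v2 \<noteq> v3"
    and p: "tform p v1 = 0" "tform p v2 = 0" "tform p v3 = 0" "p \<noteq> 0" and z: "tform p z = 0"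
  obtains c1 c2 c3 where "z = c1 *\<^sub>R v1 + c2 *\<^sub>R v2 + c3 *\<^sub>R v3"
proof -
  have p12: "tform v1 v2 > 0" "tform v1 v3 > 0" "tform v2 v3 > 0" using pos v by auto
  have ind: "independent {v1, v2, v3}"
  proof (rule ccontr)
    assume "\<not> independent {v1, v2, v3}"
    then obtain u where u: "\<exists>v\<in>{v1, v2, v3}. u v \<noteq> 0" "(\<Sum>v\<in>{v1, v2, v3}. u v *\<^sub>R v) = 0"
      by (auto simp: dependent_finite)
    have u0: "u v1 *\<^sub>R v1 + u v2 *\<^sub>R v2 + u v3 *\<^sub>R v3 = 0" using u(2) v by (simp add: add.assoc)
    have e: "u v2 * tform v1 v2 + u v3 * tform v1 v3 = 0"
      "u v1 * tform v1 v2 + u v3 * tform v2 v3 = 0"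
      "u v1 * tform v1 v3 + u v2 * tform v2 v3 = 0"
      using arg_cong[OF u0, of "tform v1"] arg_cong[OF u0, of "tform v2"] arg_cong[OF u0, of "tform v3"] v
      by (simp_all add: tform_simps null tform_commute[of v2 v1] tform_commute[of v3 v1] tform_commute[of v3 v2])
    let ?a = "tform v1 v2" and ?b = "tform v1 v3" and ?c = "tform v2 v3"
    have "2 * u v1 * (?a * ?b) = ?b * (u v1 * ?a + u v3 * ?c) + ?a * (u v1 * ?b + u v2 * ?c)
        - ?c * (u v2 * ?a + u v3 * ?b)" by (simp add: algebra_simps)
    then have "u v1 = 0" unfolding e using p12 by simp
    then show False using e u(1) p12 by simp
  qed
  have "{z. flip p \<bullet> z = 0} \<subseteq> span {v1, v2, v3}"
  proof (rule card_ge_dim_independent[OF _ ind])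
    show "{v1, v2, v3} \<subseteq> {z. flip p \<bullet> z = 0}" using p by (simp add: tform_flip)
    show "dim {z. flip p \<bullet> z = 0} \<le> card {v1, v2, v3}" using v p(4) by (simp add: dim_hyperplane flip_eq_0)
  qed
  then have "z \<in> span {v1, v2, v3}" using z by (auto simp: tform_flip)
  then obtain u where "z = (\<Sum>v\<in>{v1, v2, v3}. u v *\<^sub>R v)" by (auto simp: span_finite)
  then show ?thesis using that[of "u v1" "u v2" "u v3"] v by (simp add: add.assoc)
qed

lemma triangle_edge:
  assumes p: "tform p p > 0" "\<forall>v\<in>K. tform p v \<ge> 0"
    and v: "v1 \<in> K" "v2 \<in> K" "v3 \<in> K" "v1 \<noteq> v2" "v1 \<noteq> v3" "v2 \<noteq> v3"
    and pv: "tform p v1 = 0" "tform p v2 = 0" "tform p v3 = 0"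
    and a: "a1 \<ge> 0" "a2 \<ge> 0" "a3 \<ge> 0" "a1 = 0 \<or> a2 = 0 \<or> a3 = 0"
    and x: "x = a1 *\<^sub>R v1 + a2 *\<^sub>R v2 + a3 *\<^sub>R v3" and y: "y \<in> nonneg_comb K"
  shows "tform x x * tform y y \<le> C * (tform x y)\<^sup>2"
  using a(4)
proof (elim disjE)
  assume "a1 = 0"
  then show ?thesis using edge[OF p v(2,3,6) pv(2,3) a(2,3) _ y, of x] x by simp
next
  assume "a2 = 0"
  then show ?thesis using edge[OF p v(1,3,5) pv(1,3) a(1,3) _ y, of x] x by simp
next
  assume "a3 = 0"
  then show ?thesis using edge[OF p v(1,2,4) pv(1,2) a(1,2) _ y, of x] x by simp
qed

text \<open>
  With \<open>X\<close>, \<open>Y\<close> normalised to \<open>\<langle>X, X\<rangle> = \<langle>Y, Y\<rangle> = 1\<close> and \<open>c = \<langle>X, Y\<rangle>\<close>, let \<open>Z\<close> be orthogonal to \<open>X\<close>, \<open>Y\<close> and \<open>p\<close>.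
  Then \<open>Z\<close> is spacelike, and it is also orthogonal to \<open>q\<close>, which is a combination of \<open>X\<close> and \<open>Y\<close>. Moving
  both points by \<open>s Z\<close> subtracts the same \<open>\<sigma> = - s\<^sup>2 \<langle>Z, Z\<rangle> \<ge> 0\<close> from the three products, and the
  inequality \<open>(1 - \<sigma>)\<^sup>2 \<le> C (c - \<sigma>)\<^sup>2\<close>, valid once an edge is reached, implies \<open>1 \<le> C c\<^sup>2\<close> because \<open>C \<ge> 1\<close>.
\<close>

lemma hull_bound:
  assumes x0: "x0 \<in> convex hull K" and y0: "y0 \<in> convex hull K"
  shows "tform x0 x0 * tform y0 y0 \<le> C * (tform x0 y0)\<^sup>2"
proof (rule ccontr)
  let ?H = "convex hull K"
  assume "\<not> ?thesis"
  then have viol0: "C * (tform x0 y0)\<^sup>2 < tform x0 x0 * tform y0 y0" by simp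
  have HC: "u \<in> nonneg_comb K" if "u \<in> ?H" for u
    using that convex_hull_subset_nonneg_comb by blast
  have timelike: "tform u u > 0 \<and> tform w w > 0"
    if "u \<in> ?H" "w \<in> ?H" "C * (tform u w)\<^sup>2 < tform u u * tform w w" for u w
  proof -
    have "tform u u \<ge> 0" "tform w w \<ge> 0" using that HC tform_comb_nonneg by auto
    moreover have "tform u u * tform w w > 0"
      using that(3) C by (smt (verit) mult_nonneg_nonneg zero_le_power2)
    ultimately show ?thesis by (auto simp: zero_less_mult_iff)
  qed
  have "tform y0 y0 > 0" using timelike[OF x0 y0 viol0] by simp
  then obtain x k p where x: "x \<in> ?H" "C * (tform x y0)\<^sup>2 < tform x x * tform y0 y0"
    and p: "tform p p > 0" "\<forall>v\<in>K. tform p v \<ge> 0" "tform p x = 0"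
    using ex_support_plane[OF y0 _ x0 viol0] by metis
  have xx: "tform x x > 0" using timelike[OF x(1) y0 x(2)] by simp
  have "C * (tform y0 x)\<^sup>2 < tform y0 y0 * tform x x" using x(2) by (simp add: tform_commute[of y0 x] mult.commute)
  then obtain y l q where y: "y \<in> ?H" "C * (tform y x)\<^sup>2 < tform y y * tform x x"
    and q_eq: "q = l *\<^sub>R x - y"
    and q: "tform q q > 0" "\<forall>v\<in>K. tform q v \<ge> 0" "tform q y = 0"
    using ex_support_plane[OF x(1) xx y0] by metis
  have yy: "tform y y > 0" using timelike[OF y(1) x(1) y(2)] by simp
  have pq0: "p \<noteq> 0" "q \<noteq> 0" using p(1) q(1) by (auto simp: tform_simps)
  define X where "X = (1 / sqrt (tform x x)) *\<^sub>R x"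
  define Y where "Y = (1 / sqrt (tform y y)) *\<^sub>R y"
  have X1: "tform X X = 1" and Y1: "tform Y Y = 1" using xx yy by (simp_all add: X_def Y_def tform_simps)
  define c where "c = tform X Y"
  have "c\<^sup>2 = (tform y x)\<^sup>2 / (tform y y * tform x x)"
    using xx yy by (simp add: c_def X_def Y_def tform_simps tform_commute[of x y] power_divide power_mult_distrib)
  then have Cc: "C * c\<^sup>2 < 1" using y(2) xx yy by (simp add: pos_divide_less_eq)
  have XYC: "X \<in> nonneg_comb K" "Y \<in> nonneg_comb K"
    unfolding X_def Y_def using xx yy
    by (auto intro: nonneg_comb_scaleR[OF HC[OF x(1)]] nonneg_comb_scaleR[OF HC[OF y(1)]])
  have c0: "c \<ge> 0" unfolding c_def by (rule tform_comb_nonneg[OF XYC])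
  have c1: "c < 1"
  proof (rule ccontr)
    assume "\<not> c < 1"
    then have "1 \<le> c\<^sup>2" by (simp add: one_le_power)
    then have "1 * 1 \<le> C * c\<^sup>2" using C by (intro mult_mono) auto
    then show False using Cc by simp
  qed
  \<comment> \<open>Inside the cone, moving along a spacelike direction orthogonal to both points never
    leads to a pair that satisfies the inequality.\<close>
  have no_edge: "\<not> tform (X + s *\<^sub>R Z) (X + s *\<^sub>R Z) * tform (Y + s *\<^sub>R Z) (Y + s *\<^sub>R Z) \<le> C * (tform (X + s *\<^sub>R Z) (Y + s *\<^sub>R Z))\<^sup>2"
    if Z: "tform X Z = 0" "tform Y Z = 0" "tform Z Z \<le> 0"
      and in_cone: "X + s *\<^sub>R Z \<in> nonneg_comb K" "Y + s *\<^sub>R Z \<in> nonneg_comb K" for s Z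
  proof
    assume le: "tform (X + s *\<^sub>R Z) (X + s *\<^sub>R Z) * tform (Y + s *\<^sub>R Z) (Y + s *\<^sub>R Z) \<le> C * (tform (X + s *\<^sub>R Z) (Y + s *\<^sub>R Z))\<^sup>2"
    define \<sigma> where "\<sigma> = - (s\<^sup>2 * tform Z Z)"
    have \<sigma>: "\<sigma> \<ge> 0" using Z(3) by (simp add: \<sigma>_def mult_nonneg_nonpos)
    have e: "tform (X + s *\<^sub>R Z) (X + s *\<^sub>R Z) = 1 - \<sigma>" "tform (Y + s *\<^sub>R Z) (Y + s *\<^sub>R Z) = 1 - \<sigma>"
      "tform (X + s *\<^sub>R Z) (Y + s *\<^sub>R Z) = c - \<sigma>"
      using Z X1 Y1 by (simp_all add: tform_simps tform_commute[of Z X] tform_commute[of Z Y] \<sigma>_def c_def power2_eq_square)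
    have c\<sigma>: "c - \<sigma> \<ge> 0" using tform_comb_nonneg[OF in_cone] by (simp add: e)
    have "(1 - \<sigma>)\<^sup>2 \<le> (sqrt C * (c - \<sigma>))\<^sup>2"
      using le C by (simp add: e power2_eq_square[of "1 - \<sigma>"] power_mult_distrib)
    then have "1 - \<sigma> \<le> sqrt C * (c - \<sigma>)"
      by (rule power2_le_imp_le) (use C c\<sigma> in simp)
    moreover have "\<sigma> \<le> sqrt C * \<sigma>" using C \<sigma> mult_right_mono[of 1 "sqrt C" \<sigma>] by simp
    ultimately have "1 \<le> sqrt C * c" by (simp add: algebra_simps)
    then have "1 \<le> (sqrt C * c)\<^sup>2" by (simp add: one_le_power)
    then show False using Cc C by (simp add: power_mult_distrib)
  qed
  show False
  proof (cases rule: face_decomposition[OF x(1) xx p(2,3) pq0(1)])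
    case (1 v1 v2 a1 a2)
    then have "tform x x * tform y y \<le> C * (tform x y)\<^sup>2"
      using edge[OF p(1,2)] HC[OF y(1)] by blast
    then show False using y(2) by (simp add: tform_commute[of y x] mult.commute)
  next
    case X: (2 v1 v2 v3 a1 a2 a3)
    show False
    proof (cases rule: face_decomposition[OF y(1) yy q(2,3) pq0(2)])
      case (1 w1 w2 b1 b2)
      then have "tform y y * tform x x \<le> C * (tform y x)\<^sup>2"
        using edge[OF q(1,2)] HC[OF x(1)] by blast
      then show False using y(2) by simp
    next
      case Y: (2 w1 w2 w3 b1 b2 b3)
      obtain Z where Z: "Z \<noteq> 0" "tform X Z = 0" "tform Y Z = 0" "tform p Z = 0"
        by (rule ex_tform_orthogonal)
      have ZZ: "tform Z Z < 0"
        using tform_neg_orthogonal[OF X1 Y1 _ Z(1-3)] c0 c1 by (simp add: c_def)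
      have "tform x Z = 0" "tform y Z = 0" using Z(2,3) xx yy by (simp_all add: X_def Y_def tform_simps)
      then have qZ: "tform q Z = 0" by (simp add: q_eq tform_simps)
      obtain c1 c2 c3 where zc: "Z = c1 *\<^sub>R v1 + c2 *\<^sub>R v2 + c3 *\<^sub>R v3"
        by (rule triangle_spans_plane[OF X(1-9) pq0(1) Z(4)])
      obtain d1 d2 d3 where zd: "Z = d1 *\<^sub>R w1 + d2 *\<^sub>R w2 + d3 *\<^sub>R w3"
        by (rule triangle_spans_plane[OF Y(1-9) pq0(2) qZ])
      define \<alpha> where "\<alpha> = 1 / sqrt (tform x x)"
      define \<beta> where "\<beta> = 1 / sqrt (tform y y)"
      have X_eq: "X = \<alpha> *\<^sub>R x" and Y_eq: "Y = \<beta> *\<^sub>R y" by (simp_all add: X_def Y_def \<alpha>_def \<beta>_def)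
      have \<alpha>\<beta>: "\<alpha> > 0" "\<beta> > 0" using xx yy by (simp_all add: \<alpha>_def \<beta>_def)
      \<comment> \<open>Starting values and velocities of the six coordinates with respect to the
        vertices of the two triangles; since \<open>Z\<close> is spacelike it is not in the cone, so one
        of them decreases.\<close>
      define P where "P = {(\<alpha> * a1, c1), (\<alpha> * a2, c2), (\<alpha> * a3, c3), (\<beta> * b1, d1), (\<beta> * b2, d2), (\<beta> * b3, d3)}"
      have "\<not> (c1 \<ge> 0 \<and> c2 \<ge> 0 \<and> c3 \<ge> 0)"
      proof
        assume "c1 \<ge> 0 \<and> c2 \<ge> 0 \<and> c3 \<ge> 0"
        then have "Z \<in> nonneg_comb K" unfolding zc using X by (intro nonneg_comb_3) auto
        then show False using tform_comb_nonneg[of Z Z] ZZ by simp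
      qed
      then have "c1 < 0 \<or> c2 < 0 \<or> c3 < 0" by linarith
      moreover have "(\<alpha> * a1, c1) \<in> P" "(\<alpha> * a2, c2) \<in> P" "(\<alpha> * a3, c3) \<in> P"
        by (simp_all add: P_def)
      ultimately obtain a z where az: "(a, z) \<in> P" "z < 0" by blast
      have "finite P" "\<And>a z. (a, z) \<in> P \<Longrightarrow> a \<ge> 0" using X Y \<alpha>\<beta> by (auto simp: P_def)
      then obtain s where s: "\<And>a z. (a, z) \<in> P \<Longrightarrow> a + s * z \<ge> 0" "\<exists>(a, z) \<in> P. a + s * z = 0"
        using exit_time[OF _ _ az] by metis
      have Xs: "X + s *\<^sub>R Z = (\<alpha> * a1 + s * c1) *\<^sub>R v1 + (\<alpha> * a2 + s * c2) *\<^sub>R v2 + (\<alpha> * a3 + s * c3) *\<^sub>R v3"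
        unfolding X_eq zc X(13) by (simp add: algebra_simps)
      have Ys: "Y + s *\<^sub>R Z = (\<beta> * b1 + s * d1) *\<^sub>R w1 + (\<beta> * b2 + s * d2) *\<^sub>R w2 + (\<beta> * b3 + s * d3) *\<^sub>R w3"
        unfolding Y_eq zd Y(13) by (simp add: algebra_simps)
      have nn: "\<alpha> * a1 + s * c1 \<ge> 0" "\<alpha> * a2 + s * c2 \<ge> 0" "\<alpha> * a3 + s * c3 \<ge> 0"
        "\<beta> * b1 + s * d1 \<ge> 0" "\<beta> * b2 + s * d2 \<ge> 0" "\<beta> * b3 + s * d3 \<ge> 0"
        by (rule s(1); simp add: P_def)+
      have Xc: "X + s *\<^sub>R Z \<in> nonneg_comb K" unfolding Xs by (rule nonneg_comb_3[OF X(1-6) nn(1-3)])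
      have Yc: "Y + s *\<^sub>R Z \<in> nonneg_comb K" unfolding Ys by (rule nonneg_comb_3[OF Y(1-6) nn(4-6)])
      note contra = no_edge[OF Z(2,3) less_imp_le[OF ZZ] Xc Yc]
      have "(\<alpha> * a1 + s * c1 = 0 \<or> \<alpha> * a2 + s * c2 = 0 \<or> \<alpha> * a3 + s * c3 = 0) \<or>
          (\<beta> * b1 + s * d1 = 0 \<or> \<beta> * b2 + s * d2 = 0 \<or> \<beta> * b3 + s * d3 = 0)"
        using s(2) by (auto simp: P_def)
      then show False
      proof
        assume "\<alpha> * a1 + s * c1 = 0 \<or> \<alpha> * a2 + s * c2 = 0 \<or> \<alpha> * a3 + s * c3 = 0"
        from triangle_edge[OF p(1,2) X(1-9) nn(1-3) this Xs Yc] show False using contra by simp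
      next
        assume "\<beta> * b1 + s * d1 = 0 \<or> \<beta> * b2 + s * d2 = 0 \<or> \<beta> * b3 + s * d3 = 0"
        from triangle_edge[OF q(1,2) Y(1-9) nn(4-6) this Ys Xc] show False
          using contra by (simp add: mult.commute tform_commute[of "Y + s *\<^sub>R Z" "X + s *\<^sub>R Z"])
      qed
    qed
  qed
qed

end

section \<open>Points on a segment in a support plane\<close>

text \<open>
  The points \<open>(b j, c j)\<close> lie in the double wedge between the lines \<open>b = c\<close> and \<open>b = r\<^sup>2 c\<close> in the
  positive quadrant, and between \<open>b = c\<close> and \<open>c = r\<^sup>2 b\<close> in the negative one. With \<open>P\<close> and \<open>M\<close> the sums of
  \<open>sqrt (b j * c j)\<close> over the two quadrants,
  \<open>sum b \<le> r P - M / r\<close> and \<open>- sum c \<le> r M - P / r\<close>; the product of the two bounds is at most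
  \<open>((r - 1/r) / 2)\<^sup>2 (P + M)\<^sup>2\<close>, and the Cauchy-Schwarz inequality bounds \<open>(P + M)\<^sup>2\<close>.
\<close>

lemma wedge_sum_bound:
  fixes b c :: "'i \<Rightarrow> real" and r \<kappa> :: real
  assumes fin: "finite J" and r: "r \<ge> 1" and \<kappa>: "\<kappa> \<ge> 0"
    and a: "\<And>j. j \<in> J \<Longrightarrow> a j \<ge> 0" and d: "\<And>j. j \<in> J \<Longrightarrow> d j \<ge> 0"
    and bc: "\<And>j. j \<in> J \<Longrightarrow> b j * c j = \<kappa> * (a j * d j)"
    and le: "\<And>j. j \<in> J \<Longrightarrow> c j \<le> b j"
    and pos: "\<And>j. j \<in> J \<Longrightarrow> b j > 0 \<Longrightarrow> c j > 0 \<Longrightarrow> b j \<le> r\<^sup>2 * c j"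
    and neg: "\<And>j. j \<in> J \<Longrightarrow> b j < 0 \<Longrightarrow> c j < 0 \<Longrightarrow> r\<^sup>2 * b j \<le> c j"
    and z: "\<And>j. j \<in> J \<Longrightarrow> b j * c j = 0 \<Longrightarrow> b j = 0 \<and> c j = 0"
  shows "- (sum b J * sum c J) \<le> \<kappa> * ((r - 1 / r) / 2)\<^sup>2 * (sum a J * sum d J)"
proof (cases "sum b J > 0 \<and> sum c J < 0")
  case False
  have "sum c J \<le> sum b J" using le by (rule sum_mono)
  with False have "sum b J * sum c J \<ge> 0"
    by (smt (verit) mult_nonneg_nonneg mult_nonpos_nonpos)
  moreover have "0 \<le> \<kappa> * ((r - 1 / r) / 2)\<^sup>2 * (sum a J * sum d J)"
    using \<kappa> by (intro mult_nonneg_nonneg sum_nonneg a d) auto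
  ultimately show ?thesis by linarith
next
  case True
  define p where "p j = (if b j > 0 then sqrt (b j * c j) else 0)" for j
  define n where "n j = (if b j > 0 then 0 else sqrt (b j * c j))" for j
  have bc0: "b j * c j \<ge> 0" if "j \<in> J" for j using bc a d \<kappa> that by auto
  have r0: "r > 0" using r by simp
  have B: "b j \<le> r * p j - n j / r \<and> - c j \<le> r * n j - p j / r" if j: "j \<in> J" for j
  proof -
    consider "b j > 0" "c j > 0" | "b j < 0" "c j < 0" | "b j = 0" "c j = 0"
      using bc0[OF j] z[OF j] by (metis linorder_neqE_linordered_idom mult_eq_0_iff mult_neg_pos mult_pos_neg not_less)
    then show ?thesis
    proof cases
      case 1
      let ?s = "sqrt (b j * c j)"
      have s0: "?s > 0" using 1 by simp
      have "(b j)\<^sup>2 \<le> r\<^sup>2 * (b j * c j)"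
        using pos[OF j 1] 1 by (simp add: power2_eq_square mult_left_mono mult.left_commute)
      then have "b j \<le> sqrt (r\<^sup>2 * (b j * c j))" by (simp add: real_le_rsqrt)
      then have b1: "b j \<le> r * ?s" using r0 by (simp add: real_sqrt_mult)
      have "b j * c j \<le> (r * c j)\<^sup>2"
        using mult_right_mono[OF pos[OF j 1], of "c j"] 1 by (simp add: power2_eq_square mult_ac)
      then have "?s \<le> r * c j" using r0 1 by (simp add: real_le_lsqrt)
      then have "?s / r \<le> c j" using r0 by (simp add: field_simps)
      then show ?thesis using b1 1 by (simp add: p_def n_def)
    next
      case 2
      let ?s = "sqrt (b j * c j)"
      have "(c j)\<^sup>2 \<le> r\<^sup>2 * (b j * c j)"
        using mult_right_mono_neg[OF neg[OF j 2], of "c j"] 2 by (simp add: power2_eq_square mult_ac)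
      then have "- c j \<le> sqrt (r\<^sup>2 * (b j * c j))" by (simp add: real_le_rsqrt)
      then have c1: "- c j \<le> r * ?s" using r0 by (simp add: real_sqrt_mult)
      have "b j * c j \<le> (r * b j)\<^sup>2"
        using mult_left_mono_neg[OF neg[OF j 2], of "b j"] 2 by (simp add: power2_eq_square mult_ac)
      then have "?s \<le> sqrt ((r * (- b j))\<^sup>2)" by (simp del: real_sqrt_abs)
      then have "?s \<le> r * (- b j)" using r0 2 by (simp add: abs_mult)
      then have "b j \<le> - (?s / r)" using r0 by (simp add: field_simps)
      then show ?thesis using c1 2 by (simp add: p_def n_def)
    next
      case 3
      then show ?thesis by (simp add: p_def n_def)
    qed
  qed
  define P where "P = sum p J"
  define M where "M = sum n J"
  have P0: "P \<ge> 0" "M \<ge> 0" using bc0 by (auto simp: P_def M_def p_def n_def intro!: sum_nonneg)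
  have b1: "sum b J \<le> r * P - M / r"
    using sum_mono[of J b "\<lambda>j. r * p j - n j / r"] B
    by (simp add: P_def M_def sum_subtractf sum_distrib_left sum_divide_distrib)
  have c1: "- sum c J \<le> r * M - P / r"
    using sum_mono[of J "\<lambda>j. - c j" "\<lambda>j. r * n j - p j / r"] B
    by (simp add: P_def M_def sum_subtractf sum_distrib_left sum_divide_distrib sum_negf)
  have "P + M = (\<Sum>j\<in>J. sqrt (\<kappa> * a j) * sqrt (d j))"
    unfolding P_def M_def sum.distrib[symmetric]
    by (rule sum.cong) (auto simp: p_def n_def bc real_sqrt_mult)
  then have "(P + M)\<^sup>2 \<le> (\<Sum>j\<in>J. (sqrt (\<kappa> * a j))\<^sup>2) * (\<Sum>j\<in>J. (sqrt (d j))\<^sup>2)"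
    by (simp add: Cauchy_Schwarz_ineq_sum)
  also have "\<dots> = \<kappa> * (sum a J * sum d J)"
    using a d \<kappa> by (simp add: sum_distrib_left[symmetric] real_sqrt_mult power_mult_distrib)
  finally have CS: "(P + M)\<^sup>2 \<le> \<kappa> * (sum a J * sum d J)" .
  have "- (sum b J * sum c J) = sum b J * (- sum c J)" by simp
  also have "\<dots> \<le> (r * P - M / r) * (r * M - P / r)"
    using b1 c1 True by (intro mult_mono) auto
  also have "\<dots> = (r + 1 / r)\<^sup>2 * (P * M) - (P + M)\<^sup>2"
    using r0 by (simp add: power2_eq_square field_simps)
  also have "\<dots> \<le> (r + 1 / r)\<^sup>2 * ((P + M)\<^sup>2 / 4) - (P + M)\<^sup>2"
  proof -
    have "P * M \<le> (P + M)\<^sup>2 / 4" using sum_squares_ge_zero[of "P - M" 0] by (simp add: power2_eq_square algebra_simps)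
    from mult_left_mono[OF this, of "(r + 1 / r)\<^sup>2"] show ?thesis by simp
  qed
  also have "\<dots> = ((r - 1 / r) / 2)\<^sup>2 * (P + M)\<^sup>2"
    using r0 by (simp add: power2_eq_square field_simps)
  also have "\<dots> \<le> ((r - 1 / r) / 2)\<^sup>2 * (\<kappa> * (sum a J * sum d J))"
    using CS by (rule mult_left_mono) auto
  finally show ?thesis by (simp add: mult_ac)
qed

text \<open>
  The basis of the four tensors of \<open>u, u'\<close> with \<open>v, v'\<close> consists of two orthogonal hyperbolic pairs, so the square of
  \<open>p\<close> is a quadratic expression in its products with the basis.
\<close>

lemma tform_gram:
  "wedge u u' * wedge v v' * tform p p =
     tform p (tens u v) * tform p (tens u' v') - tform p (tens u v') * tform p (tens u' v)"
  by (simp add: tform_eq tens_nth wedge_def algebra_simps)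

text \<open>
  The scalars \<open>c t\<close> lift the graph to a curve with pairwise positive products. The distortion of harmonic
  cross-ratios is bounded by \<open>r\<^sup>2\<close>, so \<open>r\<close> plays the role of \<open>exp (N / 2)\<close>.
\<close>

locale positive_graph =
  fixes \<phi> :: "rp1 \<Rightarrow> rp1" and c :: "rp1 \<Rightarrow> real" and r :: real
  assumes pos: "s \<noteq> t \<Longrightarrow> tform (c s *\<^sub>R gtens \<phi> s) (c t *\<^sub>R gtens \<phi> t) > 0"
    and r: "r \<ge> 1"
    and harm: "cr t1 t2 t3 t4 = -1 \<Longrightarrow>
        1 / r\<^sup>2 \<le> \<bar>cr (\<phi> t1) (\<phi> t2) (\<phi> t3) (\<phi> t4)\<bar> \<and> \<bar>cr (\<phi> t1) (\<phi> t2) (\<phi> t3) (\<phi> t4)\<bar> \<le> r\<^sup>2"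
begin

definition lift :: "rp1 \<Rightarrow> real^4" where "lift t = c t *\<^sub>R gtens \<phi> t"

lemma tform_lift: "tform (lift s) (lift t) = c s * c t * (2 * hdiff s t * hdiff (\<phi> s) (\<phi> t))"
  by (simp add: lift_def tform_simps tform_gtens)

lemma tform_lift_pos: "s \<noteq> t \<Longrightarrow> tform (lift s) (lift t) > 0"
  using pos by (simp add: lift_def)

lemma tform_lift_self [simp]: "tform (lift t) (lift t) = 0"
  by (simp add: tform_lift hdiff_eq_0_iff)

lemma tform_lift_nonneg: "tform (lift s) (lift t) \<ge> 0"
  using tform_lift_pos[of s t] by (cases "s = t") auto

text \<open>
  In the basis of tensors of the parameters \<open>t1\<close> and \<open>t2\<close>, the support condition for \<open>p\<close> involves only the two mixed
  coordinates of a point of the curve, rescaled below to \<open>B\<close> and \<open>E\<close>: it says \<open>E t \<le> B t\<close>. Their product is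
  a positive multiple of the product of the other two coordinates \<open>A\<close> and \<open>D\<close>. The harmonic conjugate of \<open>t\<close>
  lies on the opposite side, where \<open>B\<close> and \<open>E\<close> have the opposite sign, so the support condition there
  bounds \<open>B / E\<close> from the other side, up to the distortion of the cross-ratio. This is the hypothesis of
  \<open>wedge_sum_bound\<close>, which controls the off-diagonal term of the Gram determinant of \<open>Y\<close>.
\<close>

lemma edge_bound:
  assumes t12: "t1 \<noteq> t2" and a: "a1 \<ge> 0" "a2 \<ge> 0"
    and p: "tform p p > 0" "\<And>t. tform p (lift t) \<ge> 0" "tform p (lift t1) = 0" "tform p (lift t2) = 0"
    and J: "finite J" "\<And>j. j \<in> J \<Longrightarrow> b j \<ge> 0"
    and X: "X = a1 *\<^sub>R lift t1 + a2 *\<^sub>R lift t2" and Y: "Y = (\<Sum>j\<in>J. b j *\<^sub>R lift (\<tau> j))"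
  shows "tform X X * tform Y Y \<le> ((r + 1 / r) / 2)\<^sup>2 * (tform X Y)\<^sup>2"
proof -
  \<comment> \<open>The coordinates of a point with respect to the basis are, up to factors, its
    products with the complementary basis vectors.\<close>
  define T12 where "T12 = tens (hvec t1) (hvec (\<phi> t2))"
  define T21 where "T21 = tens (hvec t2) (hvec (\<phi> t1))"
  define g where "g = hdiff t1 t2 * hdiff (\<phi> t1) (\<phi> t2)"
  define P12 where "P12 = tform p T12"
  define P21 where "P21 = tform p T21"
  define A where "A t = tform (lift t) (lift t1)" for t
  define D where "D t = tform (lift t) (lift t2)" for t
  define B where "B t = - g * P12 * tform (lift t) T21" for t
  define E where "E t = g * P21 * tform (lift t) T12" for t
  define c12 where "c12 = c t1 * c t2"
  \<comment> \<open>The factors \<open>g * P12\<close> and \<open>g * P21\<close> make the support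
    condition read \<open>E t \<le> B t\<close>; \<open>\<kappa>\<close> is positive because
    \<open>p\<close> is timelike, so that \<open>P12 * P21\<close> has the sign opposite to
    \<open>g\<close>, while \<open>c12\<close> has the sign of \<open>g\<close>.\<close>
  define \<kappa> where "\<kappa> = - g\<^sup>2 * P12 * P21 / c12"
  have cg: "c12 * g > 0"
    using tform_lift_pos[OF t12] by (simp add: tform_lift c12_def g_def mult_ac)
  then have nz: "c12 \<noteq> 0" "g \<noteq> 0" "c t1 \<noteq> 0" "c t2 \<noteq> 0" by (auto simp: c12_def)
  have P0: "tform p (gtens \<phi> t1) = 0" "tform p (gtens \<phi> t2) = 0"
    using p(3,4) nz by (auto simp: lift_def tform_simps)
  have gp: "g * tform p p = - P12 * P21"
    using tform_gram[of "hvec t1" "hvec t2" "hvec (\<phi> t1)" "hvec (\<phi> t2)" p] P0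
    by (simp add: g_def P12_def P21_def T12_def T21_def gtens_def wedge_hvec)
  have \<kappa>: "\<kappa> > 0"
  proof -
    have "\<kappa> = g ^ 4 * tform p p / (c12 * g)"
      using nz gp by (simp add: \<kappa>_def field_simps power2_eq_square power4_eq_xxxx)
    then show ?thesis using cg p(1) nz by simp
  qed
  have B_eq: "B t = 2 * g * P12 * (c t * hdiff t t2 * hdiff (\<phi> t1) (\<phi> t))" for t
    by (simp add: B_def lift_def gtens_def T21_def tform_simps tform_tens wedge_hvec hdiff_swap[of "\<phi> t" "\<phi> t1"])
  have E_eq: "E t = - 2 * g * P21 * (c t * hdiff t1 t * hdiff (\<phi> t) (\<phi> t2))" for t
    by (simp add: E_def lift_def gtens_def T12_def tform_simps tform_tens wedge_hvec hdiff_swap[of t t1])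
  have A_eq: "A t = 2 * c t1 * (c t * hdiff t1 t * hdiff (\<phi> t1) (\<phi> t))" for t
    by (simp add: A_def tform_lift hdiff_swap[of t t1] hdiff_swap[of "\<phi> t" "\<phi> t1"])
  have D_eq: "D t = 2 * c t2 * (c t * hdiff t t2 * hdiff (\<phi> t) (\<phi> t2))" for t
    by (simp add: D_def tform_lift)
  have BE: "B t * E t = \<kappa> * (A t * D t)" for t
    using nz by (simp add: \<kappa>_def B_eq E_eq A_eq D_eq c12_def power2_eq_square)
  have le: "E t \<le> B t" for t
  proof -
    have "g * tform p (lift t) = c t * hdiff t t2 * hdiff (\<phi> t1) (\<phi> t) * P12 + c t * hdiff t1 t * hdiff (\<phi> t) (\<phi> t2) * P21"
      using arg_cong[OF gtens_expand[of t1 t2 \<phi> t], of "\<lambda>x. c t * tform p x"] P0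
      by (simp add: lift_def tform_simps g_def P12_def P21_def T12_def T21_def algebra_simps)
    then have "B t - E t = 2 * g * (g * tform p (lift t))"
      by (simp add: B_eq E_eq algebra_simps)
    also have "\<dots> \<ge> 0" using p(2)[of t] by (simp add: mult.assoc[symmetric])
    finally show ?thesis by simp
  qed
  have key: "(B t > 0 \<longrightarrow> B t \<le> r\<^sup>2 * E t) \<and> (B t < 0 \<longrightarrow> r\<^sup>2 * B t \<le> E t)"
    if t: "t \<noteq> t1" "t \<noteq> t2" for t
  proof -
    obtain t' \<rho> where t': "\<rho> \<noteq> 0" "hdiff t' t2 = \<rho> * hdiff t t2" "hdiff t1 t' = - \<rho> * hdiff t1 t"
      "cr t1 t t2 t' = -1"
      using ex_harmonic_conjugate[OF t12 t] by metis
    have t'n: "t' \<noteq> t1" "t' \<noteq> t2"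
    proof -
      have "hdiff t' t2 \<noteq> 0" "hdiff t1 t' \<noteq> 0"
        using t'(1) t unfolding t'(2,3) by (auto simp: hdiff_eq_0_iff)
      then show "t' \<noteq> t1" "t' \<noteq> t2" by (auto simp: hdiff_eq_0_iff)
    qed
    have AD: "A t > 0" "D t > 0" "A t' > 0" "D t' > 0"
      using tform_lift_pos t t'n by (auto simp: A_def D_def)
    have opp: "B t * E t' = - \<kappa> * (A t * D t')"
      using nz by (simp add: \<kappa>_def B_eq E_eq A_eq D_eq c12_def power2_eq_square t'(2,3))
    define Q where "Q = cr (\<phi> t1) (\<phi> t) (\<phi> t2) (\<phi> t')"
    have Q: "1 / r\<^sup>2 \<le> \<bar>Q\<bar>" "\<bar>Q\<bar> \<le> r\<^sup>2" using harm[OF t'(4)] by (auto simp: Q_def)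
    have nz': "hdiff (\<phi> t1) (\<phi> t) \<noteq> 0" "hdiff (\<phi> t') (\<phi> t2) \<noteq> 0"
      using AD by (auto simp: A_eq D_eq)
    have "Q * (B t * E t') = - (E t * B t')"
      using nz' by (simp add: Q_def cr_def B_eq E_eq t'(2,3) hdiff_swap[of "\<phi> t2" "\<phi> t"]
          hdiff_swap[of "\<phi> t" "\<phi> t1"] hdiff_swap[of "\<phi> t'" "\<phi> t1"] hdiff_swap[of "\<phi> t2" "\<phi> t'"])
    then have QQ: "\<bar>Q\<bar> * (\<bar>B t\<bar> * \<bar>E t'\<bar>) = \<bar>E t\<bar> * \<bar>B t'\<bar>"
      by (metis abs_minus_cancel abs_mult)
    have up: "\<bar>E t\<bar> * \<bar>B t'\<bar> \<le> r\<^sup>2 * (\<bar>B t\<bar> * \<bar>E t'\<bar>)"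
      unfolding QQ[symmetric] using Q(2) by (rule mult_right_mono) simp
    have "1 / r\<^sup>2 * (\<bar>B t\<bar> * \<bar>E t'\<bar>) \<le> \<bar>E t\<bar> * \<bar>B t'\<bar>"
      unfolding QQ[symmetric] using Q(1) by (rule mult_right_mono) simp
    then have lo: "\<bar>B t\<bar> * \<bar>E t'\<bar> \<le> r\<^sup>2 * (\<bar>E t\<bar> * \<bar>B t'\<bar>)"
      using r by (simp add: field_simps)
    \<comment> \<open>The conjugate point lies in the opposite quadrant of the double wedge.\<close>
    have s1: "B t * E t' < 0" unfolding opp using \<kappa> AD by simp
    have s2: "B t * E t > 0" "B t' * E t' > 0" unfolding BE using \<kappa> AD by simp_all
    show ?thesis
    proof (intro conjI impI)
      assume "B t > 0"
      then have "E t > 0" "E t' < 0" "B t' < 0" using s1 s2 by (auto simp: mult_less_0_iff zero_less_mult_iff)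
      with le[of t'] have "\<bar>B t\<bar> * \<bar>B t'\<bar> \<le> \<bar>B t\<bar> * \<bar>E t'\<bar>" by (intro mult_left_mono) auto
      with lo have "\<bar>B t\<bar> * \<bar>B t'\<bar> \<le> (r\<^sup>2 * \<bar>E t\<bar>) * \<bar>B t'\<bar>" by (simp add: mult.assoc)
      then show "B t \<le> r\<^sup>2 * E t" using \<open>B t > 0\<close> \<open>E t > 0\<close> \<open>B t' < 0\<close> by simp
    next
      assume "B t < 0"
      then have "E t < 0" "E t' > 0" "B t' > 0" using s1 s2 by (auto simp: mult_less_0_iff zero_less_mult_iff)
      with le[of t'] have "r\<^sup>2 * (\<bar>B t\<bar> * \<bar>E t'\<bar>) \<le> r\<^sup>2 * (\<bar>B t\<bar> * \<bar>B t'\<bar>)" by (intro mult_left_mono) auto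
      with up have "\<bar>E t\<bar> * \<bar>B t'\<bar> \<le> (r\<^sup>2 * \<bar>B t\<bar>) * \<bar>B t'\<bar>" by (simp add: mult.assoc)
      then show "r\<^sup>2 * B t \<le> E t" using \<open>B t < 0\<close> \<open>E t < 0\<close> \<open>B t' > 0\<close> by simp
    qed
  qed
  have z0: "B t = 0 \<and> E t = 0" if "t = t1 \<or> t = t2" for t
    using that by (auto simp: B_eq E_eq hdiff_eq_0_iff)
  have AD0: "A t \<ge> 0" "D t \<ge> 0" for t by (simp_all add: A_def D_def tform_lift_nonneg)
  have BE0: "B t = 0 \<and> E t = 0" if "B t * E t = 0" for t
  proof (cases "t = t1 \<or> t = t2")
    case False
    then have "A t > 0" "D t > 0" using tform_lift_pos by (auto simp: A_def D_def)
    then show ?thesis using that \<kappa> unfolding BE by simp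
  qed (use z0 in auto)
  have "- (sum (\<lambda>j. b j * B (\<tau> j)) J * sum (\<lambda>j. b j * E (\<tau> j)) J)
      \<le> \<kappa> * ((r - 1 / r) / 2)\<^sup>2 * (sum (\<lambda>j. b j * A (\<tau> j)) J * sum (\<lambda>j. b j * D (\<tau> j)) J)"
  proof (rule wedge_sum_bound[where a = "\<lambda>j. b j * A (\<tau> j)" and b = "\<lambda>j. b j * B (\<tau> j)"
        and c = "\<lambda>j. b j * E (\<tau> j)" and d = "\<lambda>j. b j * D (\<tau> j)", OF J(1) r])
    show "\<kappa> \<ge> 0" using \<kappa> by simp
  next
    fix j assume j: "j \<in> J"
    note bj = J(2)[OF j]
    show "b j * A (\<tau> j) \<ge> 0" "b j * D (\<tau> j) \<ge> 0" using bj AD0 by auto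
    show "b j * B (\<tau> j) * (b j * E (\<tau> j)) = \<kappa> * (b j * A (\<tau> j) * (b j * D (\<tau> j)))"
    proof -
      have "b j * B (\<tau> j) * (b j * E (\<tau> j)) = (b j)\<^sup>2 * (B (\<tau> j) * E (\<tau> j))"
        by (simp add: power2_eq_square)
      then show ?thesis unfolding BE by (simp add: power2_eq_square)
    qed
    show "b j * E (\<tau> j) \<le> b j * B (\<tau> j)" by (rule mult_left_mono[OF le bj])
    show "b j * B (\<tau> j) = 0 \<and> b j * E (\<tau> j) = 0" if "b j * B (\<tau> j) * (b j * E (\<tau> j)) = 0"
    proof (cases "b j = 0")
      case False
      with that have "B (\<tau> j) * E (\<tau> j) = 0" by simp
      from BE0[OF this] show ?thesis by simp
    qed simp
    have k: "(B (\<tau> j) > 0 \<longrightarrow> B (\<tau> j) \<le> r\<^sup>2 * E (\<tau> j)) \<and> (B (\<tau> j) < 0 \<longrightarrow> r\<^sup>2 * B (\<tau> j) \<le> E (\<tau> j))"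
    proof (cases "\<tau> j = t1 \<or> \<tau> j = t2")
      case True
      from z0[OF this] show ?thesis by simp
    next
      case False
      then show ?thesis by (intro key) simp_all
    qed
    show "b j * B (\<tau> j) \<le> r\<^sup>2 * (b j * E (\<tau> j))" if "b j * B (\<tau> j) > 0"
    proof -
      have "B (\<tau> j) > 0" using that bj by (simp add: zero_less_mult_iff)
      with k have "B (\<tau> j) \<le> r\<^sup>2 * E (\<tau> j)" by simp
      from mult_left_mono[OF this bj] show ?thesis by (simp add: mult.left_commute)
    qed
    show "r\<^sup>2 * (b j * B (\<tau> j)) \<le> b j * E (\<tau> j)" if "b j * B (\<tau> j) < 0"
    proof -
      have "B (\<tau> j) < 0" using that bj by (simp add: mult_less_0_iff)
      with k have "r\<^sup>2 * B (\<tau> j) \<le> E (\<tau> j)" by simp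
      from mult_left_mono[OF this bj] show ?thesis by (simp add: mult.left_commute)
    qed
  qed
  moreover have "sum (\<lambda>j. b j * A (\<tau> j)) J = tform Y (lift t1)" "sum (\<lambda>j. b j * D (\<tau> j)) J = tform Y (lift t2)"
    by (simp_all add: Y A_def D_def tform_sum_left tform_simps)
  moreover have "sum (\<lambda>j. b j * B (\<tau> j)) J = - g * P12 * tform Y T21" "sum (\<lambda>j. b j * E (\<tau> j)) J = g * P21 * tform Y T12"
    by (simp_all add: Y B_def E_def tform_sum_left tform_simps sum_distrib_left sum_negf mult_ac)
  ultimately have off': "g\<^sup>2 * P12 * P21 * (tform Y T12 * tform Y T21)
      \<le> \<kappa> * (((r - 1 / r) / 2)\<^sup>2 * (tform Y (lift t1) * tform Y (lift t2)))"
    by (simp add: power2_eq_square mult_ac)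
  have g_eq: "g\<^sup>2 * P12 * P21 = - \<kappa> * c12" using nz by (simp add: \<kappa>_def)
  from off'[unfolded g_eq] have "\<kappa> * (- c12 * (tform Y T12 * tform Y T21))
      \<le> \<kappa> * (((r - 1 / r) / 2)\<^sup>2 * (tform Y (lift t1) * tform Y (lift t2)))"
    by (simp add: mult_ac)
  then have off: "- c12 * (tform Y T12 * tform Y T21)
      \<le> ((r - 1 / r) / 2)\<^sup>2 * (tform Y (lift t1) * tform Y (lift t2))"
    using \<kappa> mult_le_cancel_left_pos by blast
  have gY: "g * tform Y Y = tform Y (gtens \<phi> t1) * tform Y (gtens \<phi> t2) - tform Y T12 * tform Y T21"
    using tform_gram[of "hvec t1" "hvec t2" "hvec (\<phi> t1)" "hvec (\<phi> t2)" Y]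
    by (simp add: g_def T12_def T21_def gtens_def wedge_hvec)
  have "tform X X = 2 * a1 * a2 * tform (lift t1) (lift t2)"
    by (simp add: X tform_simps tform_commute[of "lift t2"])
  also have "\<dots> = 4 * (a1 * a2) * (c12 * g)"
    by (simp add: tform_lift c12_def g_def)
  finally have "tform X X * tform Y Y = 4 * (a1 * a2) * (c12 * (g * tform Y Y))"
    by simp
  also have "c12 * (g * tform Y Y) = tform Y (lift t1) * tform Y (lift t2) - c12 * (tform Y T12 * tform Y T21)"
    by (simp add: gY c12_def lift_def tform_simps algebra_simps)
  \<comment> \<open>The diagonal part is four times the product of the two summands of \<open>tform X
    Y\<close>, and is bounded by the square of their sum.\<close>
  also have "4 * (a1 * a2) * \<dots> \<le> 4 * (a1 * a2) * ((1 + ((r - 1 / r) / 2)\<^sup>2) * (tform Y (lift t1) * tform Y (lift t2)))"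
    using a off by (intro mult_left_mono) (auto simp: algebra_simps)
  also have "1 + ((r - 1 / r) / 2)\<^sup>2 = ((r + 1 / r) / 2)\<^sup>2"
    using r by (simp add: power2_eq_square field_simps)
  also have "4 * (a1 * a2) * (((r + 1 / r) / 2)\<^sup>2 * (tform Y (lift t1) * tform Y (lift t2)))
      = ((r + 1 / r) / 2)\<^sup>2 * (4 * (a1 * tform Y (lift t1)) * (a2 * tform Y (lift t2)))"
    by simp
  also have "\<dots> \<le> ((r + 1 / r) / 2)\<^sup>2 * (tform X Y)\<^sup>2"
  proof (rule mult_left_mono)
    have "tform X Y = a1 * tform Y (lift t1) + a2 * tform Y (lift t2)"
      by (simp add: X tform_simps tform_commute[of _ Y])
    then show "4 * (a1 * tform Y (lift t1)) * (a2 * tform Y (lift t2)) \<le> (tform X Y)\<^sup>2"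
      using sum_squares_ge_zero[of "a1 * tform Y (lift t1) - a2 * tform Y (lift t2)" 0]
      by (simp add: power2_eq_square algebra_simps)
  qed simp
  finally show ?thesis .
qed

end

section \<open>The graph as a curve of null vectors\<close>

text \<open>
  Up to the sign \<open>n s * n t\<close>, \<open>hdiff s t\<close> tells which of \<open>s\<close>, \<open>t\<close> is larger in the linear order with
  \<open>\<infinity>\<close> at the bottom. Preserving the cyclic order means being increasing for this order, except that the
  values below \<open>\<phi> \<infinity>\<close> are taken after those above it; the sign \<open>\<epsilon>\<close> records this jump.
\<close>

lemma orientation_preserving_sign:
  assumes "orientation_preserving_homeo \<phi>"
  shows "\<exists>\<sigma> :: rp1 \<Rightarrow> real. \<forall>s t. s \<noteq> t \<longrightarrow> \<sigma> s * \<sigma> t * (hdiff s t * hdiff (\<phi> s) (\<phi> t)) > 0"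
proof -
  have cyc: "cyclic (\<phi> x) (\<phi> y) (\<phi> z)" if "cyclic x y z" for x y z
    using assms that by (auto simp: orientation_preserving_homeo_def)
  have "inj_on \<phi> (topspace RP1)"
    using assms by (auto simp: orientation_preserving_homeo_def homeomorphic_eq_everything_map)
  moreover have "topspace RP1 = UNIV" using UNIV_option_conv by auto
  ultimately have "inj \<phi>" by (simp only:)
  then have inj: "\<phi> s \<noteq> \<phi> t" if "s \<noteq> t" for s t using that by (auto dest: injD)
  define n where "n t = (if t = None then - 1 else 1 :: real)" for t :: rp1
  define \<epsilon> where "\<epsilon> t = (if \<phi> t < \<phi> None then - 1 else 1 :: real)" for t
  have n: "n s * n t * hdiff s t < 0 \<longleftrightarrow> s < t" "n s * n t * hdiff s t > 0 \<longleftrightarrow> t < s" for s t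
    by (cases s; cases t; simp add: n_def)+
  have less: "(\<epsilon> s * \<epsilon> t) * ((n s * n t * hdiff s t) * (n (\<phi> s) * n (\<phi> t) * hdiff (\<phi> s) (\<phi> t))) > 0" if st: "s < t" for s t
  proof -
    have 1: "n s * n t * hdiff s t < 0" using n st by simp
    have "\<epsilon> s * \<epsilon> t = 1 \<and> \<phi> s < \<phi> t \<or> \<epsilon> s * \<epsilon> t = - 1 \<and> \<phi> t < \<phi> s"
    proof (cases s)
      case None
      then have "\<phi> None < \<phi> t \<or> \<phi> t < \<phi> None" using inj[of s t] st by (auto simp: neq_iff)
      then show ?thesis using None by (auto simp: \<epsilon>_def)
    next
      case (Some a)
      then have "cyclic None s t" using st by (simp add: cyclic_def)
      from cyc[OF this] show ?thesis by (auto simp: cyclic_def \<epsilon>_def)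
    qed
    then show ?thesis
    proof (elim disjE conjE)
      assume e: "\<epsilon> s * \<epsilon> t = 1" "\<phi> s < \<phi> t"
      then have "n (\<phi> s) * n (\<phi> t) * hdiff (\<phi> s) (\<phi> t) < 0" using n by simp
      with 1 show ?thesis unfolding e by (simp add: mult_neg_neg)
    next
      assume e: "\<epsilon> s * \<epsilon> t = - 1" "\<phi> t < \<phi> s"
      then have "n (\<phi> s) * n (\<phi> t) * hdiff (\<phi> s) (\<phi> t) > 0" using n by simp
      with 1 have "(n s * n t * hdiff s t) * (n (\<phi> s) * n (\<phi> t) * hdiff (\<phi> s) (\<phi> t)) < 0"
        by (rule mult_neg_pos)
      then show ?thesis unfolding e by simp
    qed
  qed
  show ?thesis
  proof (rule exI[of _ "\<lambda>t. \<epsilon> t * n t * n (\<phi> t)"], intro allI impI)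
    fix s t :: rp1 assume "s \<noteq> t"
    then consider "s < t" | "t < s" by (meson linorder_neqE)
    then show "\<epsilon> s * n s * n (\<phi> s) * (\<epsilon> t * n t * n (\<phi> t)) * (hdiff s t * hdiff (\<phi> s) (\<phi> t)) > 0"
    proof cases
      case 1
      from less[OF this] show ?thesis by (simp add: mult_ac)
    next
      case 2
      from less[OF this] show ?thesis
        by (simp add: mult_ac hdiff_swap[of s t] hdiff_swap[of "\<phi> s" "\<phi> t"])
    qed
  qed
qed

lemma proj_scaleR: "k \<noteq> 0 \<Longrightarrow> proj (k *\<^sub>R x) = proj x"
proof -
  assume k: "k \<noteq> 0"
  have "x \<in> span {k *\<^sub>R x}" using k span_mul[OF span_base[of "k *\<^sub>R x" "{k *\<^sub>R x}"], of "1 / k"] by simp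
  then show ?thesis
    unfolding proj_def by (intro span_eq[THEN iffD2]) (auto intro: span_mul span_base)
qed

lemma proj_eqD:
  assumes "proj x = proj y" "x \<noteq> 0"
  obtains k where "k \<noteq> 0" "x = k *\<^sub>R y"
proof -
  have "x \<in> span {y}" using assms(1) span_base[of x "{x}"] by (simp add: proj_def)
  then obtain k where "x = k *\<^sub>R y" by (auto simp: span_singleton)
  then show ?thesis using assms(2) that by force
qed

lemma proj_subset_left:
  "proj x \<subseteq> {x. Complex (x$3) (x$4) = cis a * Complex (x$1) (x$2)} \<longleftrightarrow>
     Complex (x$3) (x$4) = cis a * Complex (x$1) (x$2)" (is "?l \<longleftrightarrow> ?r")
proof
  assume ?l
  then show ?r using span_base[of x "{x}"] unfolding proj_def by blast
next
  have e: "Complex (k * p) (k * q) = of_real k * Complex p q" for k p q by (simp add: complex_eq_iff)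
  assume r: ?r
  show ?l by (auto simp: proj_def span_singleton e r)
qed

lemma proj_subset_right:
  "proj x \<subseteq> {x. Complex (x$3) (x$4) = cis a * cnj (Complex (x$1) (x$2))} \<longleftrightarrow>
     Complex (x$3) (x$4) = cis a * cnj (Complex (x$1) (x$2))" (is "?l \<longleftrightarrow> ?r")
proof
  assume ?l
  then show ?r using span_base[of x "{x}"] unfolding proj_def by blast
next
  have e: "Complex (k * p) (k * q) = of_real k * Complex p q" for k p q by (simp add: complex_eq_iff)
  assume r: ?r
  show ?l unfolding proj_def span_singleton by (auto simp: e r simp del: complex_cnj)
qed

text \<open>
  In terms of these complex numbers the point \<open>u(l) \<otimes> u(r)\<close> is \<open>z = h(l) h(r)\<close>, \<open>w = cnj (h(l)) h(r)\<close>, so its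
  left line is given by the unit number \<open>cnj (h(l)) / h(l)\<close> and its right line by \<open>h(r) / cnj (h(r))\<close>.
\<close>

definition hcpx :: "rp1 \<Rightarrow> complex" where
  "hcpx t = Complex (snd (hvec t)) (fst (hvec t))"

lemma hcpx_nz [simp]: "hcpx t \<noteq> 0"
  by (cases t) (auto simp: hcpx_def complex_eq_iff)

lemma tens_hcpx:
  "Complex (tens (hvec l) (hvec r) $ 1) (tens (hvec l) (hvec r) $ 2) = hcpx l * hcpx r"
  "Complex (tens (hvec l) (hvec r) $ 3) (tens (hvec l) (hvec r) $ 4) = cnj (hcpx l) * hcpx r"
  by (simp_all add: hcpx_def tens_nth complex_eq_iff)

lemma bdry_P_tens: "bdry_P t = proj (tens (hvec t) (hvec t))"
  by (cases t) (simp_all add: tens_def power2_eq_square)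

lemma hcpx_unit_eq:
  assumes "cnj (hcpx l) = u * hcpx l" "cnj (hcpx t) = u * hcpx t"
  shows "t = l"
proof -
  have "cnj (hcpx l) * hcpx t = cnj (hcpx t) * hcpx l" using assms by simp
  then have "fst (hvec t) * snd (hvec l) = fst (hvec l) * snd (hvec t)"
    by (auto simp: hcpx_def complex_eq_iff)
  then have "hdiff l t = 0" by (simp add: wedge_def mult.commute flip: wedge_hvec)
  then show ?thesis by (simp add: hdiff_eq_0_iff)
qed

lemma ex_hcpx_unit: "\<exists>a. cnj (hcpx t) = cis a * hcpx t"
proof -
  have "norm (cnj (hcpx t) / hcpx t) = 1" by (simp add: norm_divide)
  then obtain a where "cnj (hcpx t) / hcpx t = cis a"
    by (metis cis_Arg sgn_eq div_by_1 norm_zero of_real_1 zero_neq_one)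
  then have "cnj (hcpx t) = cis a * hcpx t" by (simp add: field_simps)
  then show ?thesis by blast
qed

lemma proj_l_tens: "proj_l (proj (tens (hvec l) (hvec r))) = l"
proof -
  have "(\<exists>L\<in>left_ruling. proj (tens (hvec l) (hvec r)) \<subseteq> L \<and> bdry_P t \<subseteq> L) \<longleftrightarrow> t = l" for t
  proof -
    have "(\<exists>L\<in>left_ruling. proj (tens (hvec l) (hvec r)) \<subseteq> L \<and> bdry_P t \<subseteq> L) \<longleftrightarrow>
        (\<exists>a. cnj (hcpx l) = cis a * hcpx l \<and> cnj (hcpx t) = cis a * hcpx t)"
      by (simp add: left_ruling_def bdry_P_tens proj_subset_left tens_hcpx mult.assoc[symmetric])
    also have "\<dots> \<longleftrightarrow> t = l" using hcpx_unit_eq ex_hcpx_unit[of l] by blast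
    finally show ?thesis .
  qed
  then show ?thesis by (simp add: proj_l_def)
qed

lemma proj_r_tens: "proj_r (proj (tens (hvec l) (hvec r))) = r"
proof -
  have "(\<exists>L\<in>right_ruling. proj (tens (hvec l) (hvec r)) \<subseteq> L \<and> bdry_P t \<subseteq> L) \<longleftrightarrow> t = r" for t
  proof -
    have eq: "cnj (hcpx l) * hcpx r = cis a * cnj (hcpx l * hcpx r) \<longleftrightarrow> cnj (hcpx r) = cis (- a) * hcpx r" for a l r
    proof -
      have "cnj (hcpx l) * hcpx r = cis a * cnj (hcpx l * hcpx r) \<longleftrightarrow> hcpx r = cis a * cnj (hcpx r)"
        by (simp add: mult.left_commute)
      also have "\<dots> \<longleftrightarrow> cis (- a) * hcpx r = cis (- a) * (cis a * cnj (hcpx r))" by simp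
      also have "cis (- a) * (cis a * cnj (hcpx r)) = cnj (hcpx r)"
        by (simp add: cis_mult flip: mult.assoc)
      finally show ?thesis by auto
    qed
    have "(\<exists>L\<in>right_ruling. proj (tens (hvec l) (hvec r)) \<subseteq> L \<and> bdry_P t \<subseteq> L) \<longleftrightarrow>
        (\<exists>a. cnj (hcpx r) = cis (- a) * hcpx r \<and> cnj (hcpx t) = cis (- a) * hcpx t)"
      by (simp only: right_ruling_def bex_simps bdry_P_tens proj_subset_right tens_hcpx eq)
    also have "\<dots> \<longleftrightarrow> t = r" using hcpx_unit_eq ex_hcpx_unit[of r] by (metis minus_minus)
    finally show ?thesis .
  qed
  then show ?thesis by (simp add: proj_r_def)
qed

text \<open>
  An isotropic vector is a singular two by two matrix, hence has rank at most one.
\<close>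

lemma isotropic_is_tens:
  assumes "form22 x x = 0"
  obtains u v where "x = tens u v"
proof -
  \<comment> \<open>The entries of \<open>x\<close> as a matrix: \<open>p q = g d\<close> is the
    vanishing of its determinant.\<close>
  define p where "p = (x$1 + x$3) / 2"
  define q where "q = (x$3 - x$1) / 2"
  define g where "g = (x$2 - x$4) / 2"
  define d where "d = (x$2 + x$4) / 2"
  have xs: "x$1 = p - q" "x$2 = g + d" "x$3 = p + q" "x$4 = d - g"
    by (simp_all add: p_def q_def g_def d_def field_simps)
  have pq: "p * q = g * d"
    using assms unfolding form22_def xs by (simp add: algebra_simps)
  consider "p \<noteq> 0" | "p = 0" "g = 0" | "p = 0" "d = 0" using pq by force
  then show ?thesis
  proof cases
    case 1
    then have "x = tens (g, p) (d / p, 1)"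
      using pq by (simp add: vec_eq_iff forall_4 tens_nth xs field_simps)
    then show ?thesis by (rule that)
  next
    case 2
    then have "x = tens (q, d) (1, 0)" by (simp add: vec_eq_iff forall_4 tens_nth xs)
    then show ?thesis by (rule that)
  next
    case 3
    then have "x = tens (1, 0) (q, g)" by (simp add: vec_eq_iff forall_4 tens_nth xs)
    then show ?thesis by (rule that)
  qed
qed

lemma gr_subset: "gr \<phi> \<subseteq> range (\<lambda>t. proj (gtens \<phi> t))"
proof
  fix \<xi> assume \<xi>: "\<xi> \<in> gr \<phi>"
  then obtain x where x: "x \<noteq> 0" "form22 x x = 0" "\<xi> = proj x" by (auto simp: gr_def bdry_AdS3_def)
  obtain u v where uv: "x = tens u v" using isotropic_is_tens[OF x(2)] .
  have "u \<noteq> 0" "v \<noteq> 0" using x(1) by (auto simp: uv vec_eq_iff tens_nth forall_4)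
  then obtain a l b r where "a \<noteq> 0" "u = a *\<^sub>R hvec l" "b \<noteq> 0" "v = b *\<^sub>R hvec r" using ex_hvec by metis
  then have ab: "a * b \<noteq> 0" "x = (a * b) *\<^sub>R tens (hvec l) (hvec r)"
    by (simp_all add: uv vec_eq_iff forall_4 tens_nth algebra_simps)
  then have \<xi>2: "\<xi> = proj (tens (hvec l) (hvec r))" using x(3) proj_scaleR by metis
  then have "r = \<phi> l" using \<xi> by (simp add: gr_def proj_l_tens proj_r_tens)
  then show "\<xi> \<in> range (\<lambda>t. proj (gtens \<phi> t))" using \<xi>2 by (auto simp: gtens_def)
qed

section \<open>Compactness and the convex hull\<close>

lemma continuous_map_RP1I:
  fixes f :: "rp1 \<Rightarrow> 'a::metric_space"
  assumes cont: "continuous_on UNIV (\<lambda>x. f (Some x))" and lim: "((\<lambda>x. f (Some x)) \<longlongrightarrow> f None) at_infinity"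
  shows "continuous_map RP1 euclidean f"
  unfolding continuous_map
proof (intro conjI allI impI)
  fix U :: "'a set" assume "openin euclidean U"
  then have U: "open U" by simp
  have V: "open {x. f (Some x) \<in> U}" using continuous_open_preimage[OF cont open_UNIV U] by (simp add: vimage_def)
  show "openin RP1 {x \<in> topspace RP1. f x \<in> U}"
  proof (cases "f None \<in> U")
    case False
    then have "{x \<in> topspace RP1. f x \<in> U} = Some ` {x. f (Some x) \<in> U}"
    proof (intro set_eqI)
      show "x \<in> {x \<in> topspace RP1. f x \<in> U} \<longleftrightarrow> x \<in> Some ` {x. f (Some x) \<in> U}" for x
        using False by (cases x) auto
    qed
    then show ?thesis using V by simp
  next
    case True
    define C where "C = {x. f (Some x) \<notin> U}"
    have C: "closed C" using V by (simp add: C_def closed_def Compl_eq)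
    have "\<forall>\<^sub>F x in at_infinity. f (Some x) \<in> U" using lim U True by (rule topological_tendstoD)
    then obtain b where "\<And>x. b \<le> norm x \<Longrightarrow> f (Some x) \<in> U" by (auto simp: eventually_at_infinity)
    then have "norm x \<le> b" if "x \<in> C" for x using that by (force simp: C_def)
    then have "bounded C" by (rule boundedI)
    then have "compactin euclidean C" using C by (simp add: compact_eq_bounded_closed)
    moreover have "{x \<in> topspace RP1. f x \<in> U} = insert None (Some ` (topspace euclideanreal - C))"
    proof (intro set_eqI)
      show "x \<in> {x \<in> topspace RP1. f x \<in> U} \<longleftrightarrow> x \<in> insert None (Some ` (topspace euclideanreal - C))" for x
        using True by (cases x) (auto simp: C_def)
    qed
    moreover have "closedin euclidean C" using C by simp
    ultimately show ?thesis unfolding openin_Alexandroff_compactification by blast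
  qed
qed auto

text \<open>
  Two entries of the orthogonal projection of the plane to the line with homogeneous coordinate \<open>t\<close>;
  the remaining one is \<open>1\<close> minus the second. They depend continuously on \<open>t\<close>, in contrast to any
  choice of nonzero representatives.
\<close>

definition circ :: "rp1 \<Rightarrow> real \<times> real" where
  "circ t = (fst (hvec t) * snd (hvec t) / ((fst (hvec t))\<^sup>2 + (snd (hvec t))\<^sup>2),
             (snd (hvec t))\<^sup>2 / ((fst (hvec t))\<^sup>2 + (snd (hvec t))\<^sup>2))"

lemma continuous_map_circ: "continuous_map RP1 euclidean circ"
proof (rule continuous_map_RP1I)
  have nz: "x\<^sup>2 + 1 \<noteq> 0" for x :: real using zero_le_power2[of x] by linarith
  show "continuous_on UNIV (\<lambda>x. circ (Some x))"
    unfolding circ_def by (auto intro!: continuous_intros simp: nz)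
  have "((\<lambda>x::real. (x / (x\<^sup>2 + 1), 1 / (x\<^sup>2 + 1))) \<longlongrightarrow> (0, 0)) at_infinity"
    unfolding at_infinity_eq_at_top_bot by (intro filterlim_sup tendsto_Pair) real_asymp+
  then show "((\<lambda>x. circ (Some x)) \<longlongrightarrow> circ None) at_infinity"
    by (simp add: circ_def)
qed


text \<open>
  The vectors themselves do not depend continuously on \<open>t\<close>, only up to sign, but with \<open>g = gtens \<phi> t\<close> and
  \<open>h = tform p g\<close> the normalised vector \<open>g / h\<close> equals \<open>(h g) / h\<^sup>2\<close>, where numerator and denominator are quadratic
  in \<open>g\<close> and thus polynomials in the entries of the projections to the lines \<open>t\<close> and \<open>\<phi> t\<close>.
\<close>

lemma compact_normalized_graph:
  assumes \<phi>: "continuous_map RP1 RP1 \<phi>" and nz: "\<And>t. tform p (gtens \<phi> t) \<noteq> 0"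
  shows "compact (range (\<lambda>t. (1 / tform p (gtens \<phi> t)) *\<^sub>R gtens \<phi> t))"
proof -
  \<comment> \<open>The functional of \<open>p\<close> has the coefficients \<open>\<alpha>\<close>,
    \<open>\<beta>\<close>, \<open>\<gamma>\<close>, \<open>\<delta>\<close> with respect to the matrix
    entries \<open>m00\<close>, \<open>m11\<close>, \<open>m10\<close>, \<open>m01\<close> of a tensor;
    \<open>q00\<close> etc. are the products of its value on the tensor with these entries, and
    \<open>N\<close> is the square of this value, all divided by the squared norms of the two
    factors.\<close>
  define \<alpha> where "\<alpha> = p$3 - p$1"
  define \<beta> where "\<beta> = p$3 + p$1"
  define \<gamma> where "\<gamma> = - p$4 - p$2"
  define \<delta> where "\<delta> = p$4 - p$2"
  define q00 where "q00 = (\<lambda>((a, b), c, d). \<alpha> * (b * d) + \<beta> * (a * c) + \<gamma> * (a * d) + \<delta> * (b * c))"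
  define q11 where "q11 = (\<lambda>((a, b), c, d). \<alpha> * (a * c) + \<beta> * ((1 - b) * (1 - d)) + \<gamma> * ((1 - b) * c) + \<delta> * (a * (1 - d)))"
  define q10 where "q10 = (\<lambda>((a, b), c, d). \<alpha> * (a * d) + \<beta> * ((1 - b) * c) + \<gamma> * ((1 - b) * d) + \<delta> * (a * c))"
  define q01 where "q01 = (\<lambda>((a, b), c, d). \<alpha> * (b * c) + \<beta> * (a * (1 - d)) + \<gamma> * (a * c) + \<delta> * (b * (1 - d)))"
  define N where "N = (\<lambda>w. \<alpha> * q00 w + \<beta> * q11 w + \<gamma> * q10 w + \<delta> * q01 w)"
  define F :: "(real \<times> real) \<times> real \<times> real \<Rightarrow> real^4" where
    "F = (\<lambda>w. (1 / N w) *\<^sub>R ((q00 w - q11 w) *\<^sub>R axis 1 1 + (q10 w + q01 w) *\<^sub>R axis 2 1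
        + (q00 w + q11 w) *\<^sub>R axis 3 1 + (q01 w - q10 w) *\<^sub>R axis 4 1))"
  define E where "E t = (circ t, circ (\<phi> t))" for t
  have "continuous_map RP1 euclidean (\<lambda>t. circ (\<phi> t))"
    using continuous_map_compose[OF \<phi> continuous_map_circ] by (simp add: o_def)
  then have "continuous_map RP1 (prod_topology euclidean euclidean) E"
    unfolding E_def by (intro continuous_map_pairedI continuous_map_circ)
  then have "compactin (prod_topology euclidean euclidean) (E ` topspace RP1)"
    by (rule image_compactin[rotated]) (metis compact_space_Alexandroff_compactification compact_space_def)
  moreover have top: "topspace RP1 = UNIV" using UNIV_option_conv by auto
  ultimately have comp: "compact (range E)"
    unfolding top by simp
  have key: "N (E t) \<noteq> 0 \<and> F (E t) = (1 / tform p (gtens \<phi> t)) *\<^sub>R gtens \<phi> t" for t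
  proof -
    obtain u1 u0 where u: "hvec t = (u1, u0)" by fastforce
    obtain v1 v0 where v: "hvec (\<phi> t) = (v1, v0)" by fastforce
    have hn: "(fst (hvec s))\<^sup>2 + (snd (hvec s))\<^sup>2 > 0" for s
      by (cases s) (auto intro: add_nonneg_pos)
    define U where "U = u1\<^sup>2 + u0\<^sup>2"
    define V where "V = v1\<^sup>2 + v0\<^sup>2"
    have UV: "U > 0" "V > 0" using hn[of t] hn[of "\<phi> t"] by (simp_all add: u v U_def V_def)
    define a where "a = u1 * u0 / U"
    define b where "b = u0\<^sup>2 / U"
    define c where "c = v1 * v0 / V"
    define d where "d = v0\<^sup>2 / V"
    have Et: "E t = ((a, b), c, d)" by (simp add: E_def circ_def u v a_def b_def c_def d_def U_def V_def)
    have ab: "a * U = u1 * u0" "b * U = u0\<^sup>2" "(1 - b) * U = u1\<^sup>2" "c * V = v1 * v0" "d * V = v0\<^sup>2" "(1 - d) * V = v1\<^sup>2"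
      using UV by (simp_all add: a_def b_def c_def d_def left_diff_distrib) (simp_all add: U_def V_def)
    define h where "h = tform p (gtens \<phi> t)"
    have l: "h = \<alpha> * (u0 * v0) + \<beta> * (u1 * v1) + \<gamma> * (u1 * v0) + \<delta> * (u0 * v1)"
      by (simp add: h_def gtens_def tform_eq tens_nth u v \<alpha>_def \<beta>_def \<gamma>_def \<delta>_def algebra_simps)
    have pr: "U * V * (\<alpha> * (x1 * y1) + \<beta> * (x2 * y2) + \<gamma> * (x3 * y3) + \<delta> * (x4 * y4))
        = \<alpha> * ((x1 * U) * (y1 * V)) + \<beta> * ((x2 * U) * (y2 * V)) + \<gamma> * ((x3 * U) * (y3 * V)) + \<delta> * ((x4 * U) * (y4 * V))"
      for x1 x2 x3 x4 y1 y2 y3 y4 by (simp add: distrib_left mult_ac)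
    have sm: "U * V * (\<alpha> * x1 + \<beta> * x2 + \<gamma> * x3 + \<delta> * x4)
        = \<alpha> * (U * V * x1) + \<beta> * (U * V * x2) + \<gamma> * (U * V * x3) + \<delta> * (U * V * x4)"
      for x1 x2 x3 x4 by (simp add: distrib_left mult_ac)
    have q: "U * V * q00 (E t) = h * (u0 * v0)" "U * V * q11 (E t) = h * (u1 * v1)"
      "U * V * q10 (E t) = h * (u1 * v0)" "U * V * q01 (E t) = h * (u0 * v1)"
      unfolding Et q00_def q11_def q10_def q01_def prod.case pr ab l
      by (simp_all add: power2_eq_square algebra_simps)
    have "U * V * N (E t) = h\<^sup>2"
      unfolding N_def sm q by (simp add: l power2_eq_square algebra_simps)
    then have N: "N (E t) = h\<^sup>2 / (U * V)" using UV by (simp add: field_simps)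
    have q': "q00 (E t) = h * (u0 * v0) / (U * V)" "q11 (E t) = h * (u1 * v1) / (U * V)"
      "q10 (E t) = h * (u1 * v0) / (U * V)" "q01 (E t) = h * (u0 * v1) / (U * V)"
      unfolding q[symmetric] using UV by simp_all
    have l0: "h \<noteq> 0" using nz by (simp add: h_def)
    have e: "(1 / (h\<^sup>2 / W)) * (h * x / W) = 1 / h * x" if "W \<noteq> 0" for x W :: real
      using l0 that by (simp add: power2_eq_square)
    have W: "U * V \<noteq> 0" using UV by simp
    have "F (E t) = (1 / h) *\<^sub>R gtens \<phi> t"
      unfolding F_def N q'
      by (simp add: vec_eq_iff forall_4 axis_def gtens_def tens_nth u v
           right_diff_distrib distrib_left e[OF W] del: times_divide_eq_right times_divide_eq_left divide_divide_eq_left divide_divide_eq_right)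
    then show ?thesis using N l0 UV by (simp add: h_def)
  qed
  have "continuous_on (range E) F"
    unfolding F_def N_def q00_def q11_def q10_def q01_def case_prod_beta
    using key by (intro continuous_intros) (auto simp: N_def q00_def q11_def q10_def q01_def case_prod_beta)
  from compact_continuous_image[OF this comp] show ?thesis
    by (simp add: image_image key)
qed

text \<open>
  A point outside the closed convex hull of the normalised lift is strictly separated from it by a
  plane. Such a plane avoids the graph and has it on one side, and so it bounds one of the half-spaces
  that define \<open>CH\<close>; the chart is the complement of the plane of \<open>p0\<close>.
\<close>

lemma CH_subset_hull:
  assumes z: "\<And>t. z t = c t *\<^sub>R gtens \<phi> t" "\<And>t. c t \<noteq> 0" and p0: "\<And>t. tform p0 (z t) = 1"
    and K: "compact (range z)" and l: "l \<in> CH (gr \<phi>)"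
  obtains x where "x \<in> convex hull (range z)" "l = proj x"
proof -
  have grz: "\<exists>t. \<xi> = proj (z t)" if "\<xi> \<in> gr \<phi>" for \<xi>
    using that gr_subset[of \<phi>] z proj_scaleR by fastforce
  have z0: "z t \<noteq> 0" for t using p0[of t] by (auto simp: tform_simps)
  have form: "form22 x (- p) = tform p x" for x p by (simp add: form22_def tform_eq)
  have avoids: "avoids (gr \<phi>) (- p)" if p: "\<And>t. tform p (z t) \<noteq> 0" for p
  proof -
    have "plane (- p) \<inter> gr \<phi> = {}"
    proof (rule ccontr)
      assume "plane (- p) \<inter> gr \<phi> \<noteq> {}"
      then obtain x t where x: "x \<noteq> 0" "proj x = proj (z t)" "form22 x (- p) = 0"
        using grz by (fastforce simp: plane_def)
      obtain k where "k \<noteq> 0" "x = k *\<^sub>R z t" using proj_eqD[OF x(2,1)] .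
      then show False using x(3) p[of t] by (simp add: form tform_simps)
    qed
    moreover have "p \<noteq> 0" using p by (auto simp: tform_simps)
    ultimately show ?thesis by (simp add: avoids_def)
  qed
  have half: "gr \<phi> \<subseteq> half_space (- p0) (- p)" if p: "\<And>t. tform p (z t) \<ge> 0" for p
    using grz p p0 by (fastforce simp: half_space_def form)
  have sep: "\<exists>x. l = proj x \<and> tform p0 x = 1 \<and> tform p x \<ge> 0" if p: "\<And>t. tform p (z t) > 0" for p
  proof -
    have "avoids (gr \<phi>) (- p0)" "avoids (gr \<phi>) (- p)" "gr \<phi> \<subseteq> half_space (- p0) (- p)"
      using p less_imp_le[OF p] p0 by (auto intro!: avoids half simp: less_imp_neq less_imp_le) (metis less_irrefl)
    then have "l \<in> half_space (- p0) (- p)" using l by (auto simp: CH_def)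
    then show ?thesis by (auto simp: half_space_def form)
  qed
  obtain x where x: "l = proj x" "tform p0 x = 1" using sep[of p0] p0 by auto
  have "x \<in> convex hull (range z)"
  proof (rule ccontr)
    assume "x \<notin> convex hull (range z)"
    moreover have "closed (convex hull (range z))" using K by (simp add: compact_convex_hull compact_imp_closed)
    ultimately obtain a b where ab: "a \<bullet> x < b" "\<And>y. y \<in> convex hull (range z) \<Longrightarrow> b < a \<bullet> y"
      using separating_hyperplane_closed_point[of "convex hull (range z)" x] convex_convex_hull by blast
    define p where "p = flip a - b *\<^sub>R p0"
    have ff: "flip (flip a) = a" by (simp add: flip_def vec_eq_iff forall_4)
    have p: "tform p y = a \<bullet> y - b * tform p0 y" for y
      by (simp add: p_def tform_simps tform_flip[of "flip a"] ff)
    have "tform p (z t) > 0" for t using ab(2)[OF hull_inc[of "z t"]] p0 by (simp add: p)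
    then obtain x' where x': "l = proj x'" "tform p0 x' = 1" "tform p x' \<ge> 0" using sep by blast
    have "x' \<noteq> 0" using x'(2) by (auto simp: tform_simps)
    then obtain k where k: "x' = k *\<^sub>R x" using proj_eqD[of x' x] x'(1) x(1) by metis
    then have "k = 1" using x'(2) x(2) by (simp add: tform_simps)
    then show False using x'(3) x(2) ab(1) by (simp add: k p)
  qed
  then show ?thesis using that x(1) by blast
qed

section \<open>Timelike geodesics\<close>

text \<open>
  The speed is a constant \<open>\<kappa>\<close> and the geodesic equation reads \<open>\<gamma>'' = - \<kappa>\<^sup>2 \<gamma>\<close>, so the
  product with the initial point satisfies the initial value problem of the cosine.
\<close>

lemma geodesic_cos:
  assumes "timelike_geodesic_segment a b \<gamma>"
  obtains \<kappa> where "\<kappa> > 0" "timelike_length a b \<gamma> = \<kappa> * (b - a)"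
    "\<And>t. t \<in> {a..b} \<Longrightarrow> tform (\<gamma> a) (\<gamma> t) = cos (\<kappa> * (t - a))"
    "\<And>t. t \<in> {a..b} \<Longrightarrow> tform (\<gamma> t) (\<gamma> t) = 1" "continuous_on {a..b} \<gamma>"
proof -
  let ?T = "{a..b}"
  from assms obtain \<gamma>' \<gamma>'' where ab: "a < b" and geo: "\<forall>t\<in>?T.
        (\<gamma> has_vector_derivative \<gamma>' t) (at t within ?T) \<and>
        (\<gamma>' has_vector_derivative \<gamma>'' t) (at t within ?T) \<and>
        form22 (\<gamma> t) (\<gamma> t) = -1 \<and> form22 (\<gamma>' t) (\<gamma>' t) < 0 \<and> \<gamma>'' t \<in> span {\<gamma> t}"
    unfolding timelike_geodesic_segment_def by blast
  have d1: "(\<gamma> has_vector_derivative \<gamma>' t) (at t within ?T)"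
    and d2: "(\<gamma>' has_vector_derivative \<gamma>'' t) (at t within ?T)"
    and n1: "tform (\<gamma> t) (\<gamma> t) = 1"
    and tl: "tform (\<gamma>' t) (\<gamma>' t) > 0"
    and sp: "\<gamma>'' t \<in> span {\<gamma> t}" if "t \<in> ?T" for t
    using geo that by (simp_all add: tform_def)
  have bb: "bounded_bilinear tform" using bilinear_tform by (simp add: bilinear_conv_bounded_bilinear)
  note bd = bounded_bilinear.has_vector_derivative[OF bb]
  have uniq: "x = 0"
    if f: "(f has_vector_derivative x) (at t within ?T)" and c: "\<And>s. s \<in> ?T \<Longrightarrow> f s = c" and t: "t \<in> ?T"
    for f :: "real \<Rightarrow> real" and x c t
  proof -
    have "((\<lambda>_. c) has_vector_derivative x) (at t within ?T)"
      by (rule has_vector_derivative_transform[OF t _ f]) (simp add: c)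
    then have "vector_derivative (\<lambda>_. c) (at t within ?T) = x"
      using vector_derivative_within_closed_interval[OF ab t] by blast
    moreover have "vector_derivative (\<lambda>_. c) (at t within ?T) = 0"
      using vector_derivative_within_closed_interval[OF ab t] has_vector_derivative_const by blast
    ultimately show ?thesis by simp
  qed
  have orth: "tform (\<gamma> t) (\<gamma>' t) = 0" if t: "t \<in> ?T" for t
    using uniq[OF bd[OF d1[OF t] d1[OF t]] n1 t] by (simp add: tform_commute[of "\<gamma>' t"])
  have acc: "\<gamma>'' t = - tform (\<gamma>' t) (\<gamma>' t) *\<^sub>R \<gamma> t" if t: "t \<in> ?T" for t
  proof -
    obtain m where l: "\<gamma>'' t = m *\<^sub>R \<gamma> t" using sp[OF t] by (auto simp: span_singleton)
    have "tform (\<gamma> t) (\<gamma>'' t) + tform (\<gamma>' t) (\<gamma>' t) = 0"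
      using uniq[OF bd[OF d1[OF t] d2[OF t]] orth t] .
    then have "m = - tform (\<gamma>' t) (\<gamma>' t)" using n1[OF t] by (simp add: l tform_simps)
    then show ?thesis using l by simp
  qed
  have const: "\<exists>c. \<forall>t\<in>?T. f t = c"
    if "\<And>t. t \<in> ?T \<Longrightarrow> (f has_vector_derivative 0) (at t within ?T)" for f :: "real \<Rightarrow> real"
    by (rule has_vector_derivative_zero_constant[of ?T f]) (use that in auto)
  have "\<exists>c. \<forall>t\<in>?T. tform (\<gamma>' t) (\<gamma>' t) = c"
  proof (rule const)
    fix t assume t: "t \<in> ?T"
    have "tform (\<gamma>' t) (\<gamma>'' t) + tform (\<gamma>'' t) (\<gamma>' t) = 0"
      using orth[OF t] by (simp add: acc[OF t] tform_simps tform_commute[of "\<gamma>' t" "\<gamma> t"])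
    then show "((\<lambda>t. tform (\<gamma>' t) (\<gamma>' t)) has_vector_derivative 0) (at t within ?T)"
      using bd[OF d2[OF t] d2[OF t]] by simp
  qed
  then obtain c where c: "\<And>t. t \<in> ?T \<Longrightarrow> tform (\<gamma>' t) (\<gamma>' t) = c" by blast
  define \<kappa> where "\<kappa> = sqrt c"
  have "c > 0" using tl[of a] c[of a] ab by simp
  then have \<kappa>: "\<kappa> > 0" "c = \<kappa>\<^sup>2" by (simp_all add: \<kappa>_def)
  have len: "timelike_length a b \<gamma> = \<kappa> * (b - a)"
  proof -
    have "timelike_length a b \<gamma> = integral ?T (\<lambda>t. \<kappa>)"
      unfolding timelike_length_def
    proof (rule integral_cong)
      fix t assume t: "t \<in> ?T"
      have "vector_derivative \<gamma> (at t within ?T) = \<gamma>' t"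
        by (rule vector_derivative_within_closed_interval[OF ab t d1[OF t]])
      then show "(let v = vector_derivative \<gamma> (at t within ?T) in sqrt (- form22 v v)) = \<kappa>"
        using c[OF t] by (simp add: \<kappa>_def tform_def)
    qed
    then show ?thesis using ab by simp
  qed
  define h where "h t = tform (\<gamma> a) (\<gamma> t)" for t
  define h' where "h' t = tform (\<gamma> a) (\<gamma>' t)" for t
  have dh: "(h has_real_derivative h' t) (at t within ?T)" if t: "t \<in> ?T" for t
    using bd[OF has_vector_derivative_const d1[OF t], of "\<gamma> a"]
    by (simp add: h_def[abs_def] h'_def has_real_derivative_iff_has_vector_derivative tform_zero_left)
  have dh': "(h' has_real_derivative - (\<kappa>\<^sup>2 * h t)) (at t within ?T)" if t: "t \<in> ?T" for t
    using bd[OF has_vector_derivative_const d2[OF t], of "\<gamma> a"]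
    by (simp add: h'_def[abs_def] h_def has_real_derivative_iff_has_vector_derivative tform_simps acc[OF t] c[OF t] \<kappa>(2))
  have aT: "a \<in> ?T" using ab by simp
  \<comment> \<open>The position and velocity of the harmonic oscillator in rotating coordinates, where
    they are constant.\<close>
  define u where "u t = h t * cos (\<kappa> * (t - a)) - h' t / \<kappa> * sin (\<kappa> * (t - a))" for t
  define v where "v t = h t * sin (\<kappa> * (t - a)) + h' t / \<kappa> * cos (\<kappa> * (t - a))" for t
  have du: "(u has_real_derivative 0) (at t within ?T)" if t: "t \<in> ?T" for t
    unfolding u_def using \<kappa>(1)
    by (auto intro!: derivative_eq_intros dh[OF t] dh'[OF t] simp: field_simps power2_eq_square)
  have dv: "(v has_real_derivative 0) (at t within ?T)" if t: "t \<in> ?T" for t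
    unfolding v_def using \<kappa>(1)
    by (auto intro!: derivative_eq_intros dh[OF t] dh'[OF t] simp: field_simps power2_eq_square)
  have "\<exists>c. \<forall>t\<in>?T. u t = c" "\<exists>c. \<forall>t\<in>?T. v t = c"
    using du dv by (auto intro!: const simp: has_real_derivative_iff_has_vector_derivative)
  moreover have "u a = 1" "v a = 0" using n1[OF aT] orth[OF aT] by (simp_all add: u_def v_def h_def h'_def)
  ultimately have uv: "u t = 1" "v t = 0" if "t \<in> ?T" for t using that aT by metis+
  have cs: "tform (\<gamma> a) (\<gamma> t) = cos (\<kappa> * (t - a))" if t: "t \<in> ?T" for t
  proof -
    let ?c = "cos (\<kappa> * (t - a))" and ?s = "sin (\<kappa> * (t - a))"
    have rotation: "p * (s\<^sup>2 + c\<^sup>2) = (p * c - q * s) * c + (p * s + q * c) * s" for p q s c :: real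
      by (simp add: algebra_simps power2_eq_square)
    have "h t = h t * (?s\<^sup>2 + ?c\<^sup>2)" by simp
    also have "\<dots> = u t * ?c + v t * ?s" unfolding u_def v_def by (rule rotation)
    also have "\<dots> = ?c" using uv[OF t] by simp
    finally show ?thesis by (simp add: h_def)
  qed
  have "continuous_on ?T \<gamma>" using d1 by (rule continuous_on_vector_derivative)
  then show ?thesis using that \<kappa>(1) len cs n1 by blast
qed

lemma cos_nonneg_interval_le:
  assumes "L \<ge> 0" "\<And>s. 0 \<le> s \<Longrightarrow> s \<le> L \<Longrightarrow> cos s \<ge> 0"
  shows "L \<le> pi / 2"
proof (rule ccontr)
  assume "\<not> L \<le> pi / 2"
  then have m: "pi / 2 < min L pi" "min L pi \<le> pi" using pi_gt_zero by auto
  then have "cos (min L pi) < cos (pi / 2)" using pi_gt_zero by (intro cos_monotone_0_pi) auto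
  moreover have "cos (min L pi) \<ge> 0" using assms pi_gt_zero by (intro assms(2)) auto
  ultimately show False by simp
qed

section \<open>The width of the hull\<close>

lemma cr_norm_bounds:
  assumes "quasisymmetric \<phi>"
  obtains N where "cr_norm \<phi> = ereal N" "N \<ge> 0"
    "\<And>z1 z2 z3 z4. cr z1 z2 z3 z4 = -1 \<Longrightarrow> \<bar>ln \<bar>cr (\<phi> z1) (\<phi> z2) (\<phi> z3) (\<phi> z4)\<bar>\<bar> \<le> N"
proof -
  let ?Q = "{(z1, z2, z3, z4). cr z1 z2 z3 z4 = -1}"
  have le: "ereal \<bar>ln \<bar>cr (\<phi> z1) (\<phi> z2) (\<phi> z3) (\<phi> z4)\<bar>\<bar> \<le> cr_norm \<phi>" if "cr z1 z2 z3 z4 = -1" for z1 z2 z3 z4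
    unfolding cr_norm_def using that by (intro SUP_upper2[of "(z1, z2, z3, z4)"]) auto
  \<comment> \<open>A harmonic quadruple, so that the supremum is over a nonempty set of nonnegative
    numbers.\<close>
  have "cr (Some 0) (Some 1) None (Some (-1)) = -1" by (simp add: cr_def)
  from le[OF this] have "0 \<le> cr_norm \<phi>" by (rule order_trans[rotated]) simp
  moreover have "cr_norm \<phi> < \<infinity>" using assms by (simp add: quasisymmetric_def)
  ultimately obtain N where "cr_norm \<phi> = ereal N" "N \<ge> 0" by (cases "cr_norm \<phi>") auto
  then show ?thesis using that le by simp
qed

text \<open>
  The graph has the lifts \<open>gtens \<phi> t / h t\<close>, normalised by the functional of the sum \<open>p0\<close> of two signed lifts; this
  functional is positive on all signed lifts, so the normalised lifts keep their pairwise positive products.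
  The geodesic stays in one of the two opposite cones over the hull, since \<open>p0\<close> does not vanish on it; this forces
  \<open>cos \<ge> 0\<close> along the segment and hence \<open>L \<le> pi / 2\<close>, before \<open>hull_bound\<close> gives the sharper bound.
\<close>

lemma timelike_length_le:
  assumes \<phi>: "quasisymmetric \<phi>" and N: "cr_norm \<phi> = ereal N" "N \<ge> 0"
      "\<And>z1 z2 z3 z4. cr z1 z2 z3 z4 = -1 \<Longrightarrow> \<bar>ln \<bar>cr (\<phi> z1) (\<phi> z2) (\<phi> z3) (\<phi> z4)\<bar>\<bar> \<le> N"
    and seg: "timelike_geodesic_segment a b \<gamma>" "\<forall>t\<in>{a..b}. proj (\<gamma> t) \<in> CH (gr \<phi>)"
  shows "timelike_length a b \<gamma> \<le> arctan (sinh (N / 2))"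
proof -
  have op: "orientation_preserving_homeo \<phi>" using \<phi> by (simp add: quasisymmetric_def)
  have cont: "continuous_map RP1 RP1 \<phi>"
    using op by (auto simp: orientation_preserving_homeo_def homeomorphic_imp_continuous_map)
  obtain \<sigma> where \<sigma>: "\<And>s t. s \<noteq> t \<Longrightarrow> \<sigma> s * \<sigma> t * (hdiff s t * hdiff (\<phi> s) (\<phi> t)) > 0"
    using orientation_preserving_sign[OF op] by blast
  have inj: "\<phi> s \<noteq> \<phi> t" if "s \<noteq> t" for s t using \<sigma>[OF that] hdiff_eq_0_iff[of "\<phi> t" "\<phi> t"] by auto
  \<comment> \<open>Any two distinct parameters serve: a point of the graph has zero product with at
    most one of the two lifts.\<close>
  define t0 t1 where "t0 = (None :: rp1)" and "t1 = Some (0 :: real)"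
  have t01: "t0 \<noteq> t1" by (simp add: t0_def t1_def)
  define p0 where "p0 = \<sigma> t0 *\<^sub>R gtens \<phi> t0 + \<sigma> t1 *\<^sub>R gtens \<phi> t1"
  define h where "h t = tform p0 (gtens \<phi> t)" for t
  have \<sigma>h: "\<sigma> t * h t > 0" for t
  proof -
    define k where "k s = \<sigma> s * \<sigma> t * (hdiff s t * hdiff (\<phi> s) (\<phi> t))" for s
    have "\<sigma> t * h t = 2 * (k t0 + k t1)"
      by (simp add: h_def p0_def tform_simps tform_gtens k_def algebra_simps)
    moreover have "k s \<ge> 0" for s
      using \<sigma>[of s t] by (cases "s = t") (auto simp: k_def hdiff_eq_0_iff)
    moreover have "k t0 > 0 \<or> k t1 > 0" using \<sigma>[of t0 t] \<sigma>[of t1 t] t01 by (auto simp: k_def)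
    ultimately show ?thesis by (smt (verit))
  qed
  then have h0: "h t \<noteq> 0" for t by (metis less_irrefl mult_zero_right)
  define c where "c t = 1 / h t" for t
  have c0: "c t \<noteq> 0" for t using h0 by (simp add: c_def)
  define r where "r = exp (N / 2)"
  have r: "r \<ge> 1" using N(2) by (simp add: r_def)
  have r2: "r\<^sup>2 = exp N" by (simp add: r_def power2_eq_square flip: exp_add)
  interpret positive_graph \<phi> c r
  proof
    fix s t :: rp1 assume st: "s \<noteq> t"
    have "\<sigma> s * \<sigma> t * (hdiff s t * hdiff (\<phi> s) (\<phi> t)) / ((\<sigma> s * h s) * (\<sigma> t * h t)) > 0"
      by (rule divide_pos_pos[OF \<sigma>[OF st] mult_pos_pos[OF \<sigma>h \<sigma>h]])
    moreover have "\<sigma> s \<noteq> 0" "\<sigma> t \<noteq> 0" using \<sigma>h by (metis less_irrefl mult_zero_left)+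
    ultimately have "hdiff s t * hdiff (\<phi> s) (\<phi> t) / (h s * h t) > 0" by (simp add: field_simps)
    moreover have "tform (c s *\<^sub>R gtens \<phi> s) (c t *\<^sub>R gtens \<phi> t)
        = 2 * (hdiff s t * hdiff (\<phi> s) (\<phi> t) / (h s * h t))"
      by (simp add: tform_simps tform_gtens c_def mult.commute[of "h s"])
    ultimately show "tform (c s *\<^sub>R gtens \<phi> s) (c t *\<^sub>R gtens \<phi> t) > 0" by linarith
  next
    show "r \<ge> 1" by (rule r)
  next
    fix z1 z2 z3 z4 assume cr: "cr z1 z2 z3 z4 = -1"
    define x where "x = \<bar>cr (\<phi> z1) (\<phi> z2) (\<phi> z3) (\<phi> z4)\<bar>"
    have "z4 \<noteq> z1" "z3 \<noteq> z2" "z2 \<noteq> z1" "z3 \<noteq> z4"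
      using cr by (auto simp: cr_def hdiff_eq_0_iff)
    then have "x > 0" by (simp add: x_def cr_def hdiff_eq_0_iff inj)
    moreover have "\<bar>ln x\<bar> \<le> N" using N(3)[OF cr] by (simp add: x_def)
    then have "exp (- N) \<le> exp (ln x)" "exp (ln x) \<le> exp N" by (simp_all add: abs_le_iff)
    ultimately have "exp (- N) \<le> x" "x \<le> exp N" by simp_all
    then show "1 / r\<^sup>2 \<le> \<bar>cr (\<phi> z1) (\<phi> z2) (\<phi> z3) (\<phi> z4)\<bar> \<and> \<bar>cr (\<phi> z1) (\<phi> z2) (\<phi> z3) (\<phi> z4)\<bar> \<le> r\<^sup>2"
      by (simp add: x_def r2 exp_minus inverse_eq_divide)
  qed
  define K where "K = range lift"
  have p0z: "tform p0 (lift t) = 1" for t using h0[of t] by (simp add: lift_def tform_simps c_def flip: h_def)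
  have zeq: "lift = (\<lambda>t. (1 / tform p0 (gtens \<phi> t)) *\<^sub>R gtens \<phi> t)"
    by (rule ext) (unfold lift_def, simp add: c_def h_def)
  have compK: "compact K"
    unfolding K_def zeq by (rule compact_normalized_graph[OF cont]) (use h0 in \<open>simp add: h_def\<close>)
  define C where "C = ((r + 1 / r) / 2)\<^sup>2"
  have C_cosh: "C = (cosh (N / 2))\<^sup>2"
    by (simp add: C_def r_def cosh_def exp_minus inverse_eq_divide)
  interpret null_curve K p0 C
  proof
    show "compact K" by (rule compK)
    show "tform v v = 0" if "v \<in> K" for v using that by (auto simp: K_def)
    show "tform v w > 0" if "v \<in> K" "w \<in> K" "v \<noteq> w" for v w using that by (auto simp: K_def intro: tform_lift_pos)
    show "tform p0 v = 1" if "v \<in> K" for v using that p0z by (auto simp: K_def)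
    show "1 \<le> C" unfolding C_cosh using cosh_real_ge_1[of "N / 2"] by (simp add: one_le_power)
    fix p v1 v2 a1 a2 x y
    assume p: "tform p p > 0" "\<forall>v\<in>K. 0 \<le> tform p v" and v: "v1 \<in> K" "v2 \<in> K" "v1 \<noteq> v2"
      and pv: "tform p v1 = 0" "tform p v2 = 0" and a: "0 \<le> a1" "0 \<le> a2"
      and x: "x = a1 *\<^sub>R v1 + a2 *\<^sub>R v2" and y: "y \<in> nonneg_comb K"
    obtain \<tau>1 \<tau>2 where \<tau>: "v1 = lift \<tau>1" "v2 = lift \<tau>2" using v by (auto simp: K_def)
    obtain S b where S: "finite S" "S \<subseteq> K" "\<forall>v\<in>S. 0 \<le> b v" "y = (\<Sum>v\<in>S. b v *\<^sub>R v)"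
      using y by (auto simp: nonneg_comb_def)
    have y': "y = (\<Sum>v\<in>S. b v *\<^sub>R lift (inv lift v))"
      unfolding S(4) using S(2) by (intro sum.cong refl) (auto simp: K_def f_inv_into_f subset_iff)
    show "tform x x * tform y y \<le> C * (tform x y)\<^sup>2"
      unfolding C_def
    proof (rule edge_bound[OF _ a p(1) _ _ _ S(1) _ _ y'])
      show "\<tau>1 \<noteq> \<tau>2" using \<tau> v(3) by auto
      show "0 \<le> tform p (lift t)" for t using p(2) by (auto simp: K_def)
      show "tform p (lift \<tau>1) = 0" "tform p (lift \<tau>2) = 0" using pv \<tau> by auto
      show "0 \<le> b j" if "j \<in> S" for j using S(3) that by blast
      show "x = a1 *\<^sub>R lift \<tau>1 + a2 *\<^sub>R lift \<tau>2" using x \<tau> by simp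
    qed
  qed
  obtain \<kappa> where \<kappa>: "\<kappa> > 0" "timelike_length a b \<gamma> = \<kappa> * (b - a)"
    "\<And>t. t \<in> {a..b} \<Longrightarrow> tform (\<gamma> a) (\<gamma> t) = cos (\<kappa> * (t - a))"
    "\<And>t. t \<in> {a..b} \<Longrightarrow> tform (\<gamma> t) (\<gamma> t) = 1" "continuous_on {a..b} \<gamma>"
    using geodesic_cos[OF seg(1)] by metis
  have ab: "a < b" using seg(1) by (simp add: timelike_geodesic_segment_def)
  \<comment> \<open>The factor between \<open>\<gamma> t\<close> and the representative in the hull; its
    sign tells in which of the two cones \<open>\<gamma> t\<close> lies.\<close>
  define k where "k t = tform p0 (\<gamma> t)" for t
  have "\<exists>x. x \<in> convex hull K \<and> \<gamma> t = k t *\<^sub>R x \<and> k t \<noteq> 0" if t: "t \<in> {a..b}" for t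
  proof -
    have "proj (\<gamma> t) \<in> CH (gr \<phi>)" using seg(2) t by blast
    then obtain x where x: "x \<in> convex hull K" "proj (\<gamma> t) = proj x"
      using CH_subset_hull[of lift c \<phi> p0, OF lift_def c0 p0z compK[unfolded K_def]] unfolding K_def by metis
    have "\<gamma> t \<noteq> 0" using \<kappa>(4)[OF t] by (auto simp: tform_simps)
    then obtain m where m: "m \<noteq> 0" "\<gamma> t = m *\<^sub>R x" using proj_eqD[OF x(2)] by metis
    have "convex {v. tform p0 v = 1}" by (simp add: tform_flip convex_hyperplane)
    then have "convex hull K \<subseteq> {v. tform p0 v = 1}" using norm1 by (intro hull_minimal) auto
    then have "k t = m" using x(1) m by (auto simp: k_def tform_simps)
    then show ?thesis using x(1) m by blast
  qed
  then obtain x where x: "\<And>t. t \<in> {a..b} \<Longrightarrow> x t \<in> convex hull K \<and> \<gamma> t = k t *\<^sub>R x t \<and> k t \<noteq> 0"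
    by metis
  have kk: "k a * k t > 0" if t: "t \<in> {a..b}" for t
  proof (rule ccontr)
    assume "\<not> k a * k t > 0"
    moreover have "k a \<noteq> 0" "k t \<noteq> 0" using x t ab by auto
    ultimately have neg: "k a * k t < 0" by (simp add: less_le)
    have "continuous_on {a..t} (\<lambda>s. k a * k s)"
      unfolding k_def tform_eq using t by (intro continuous_intros continuous_on_subset[OF \<kappa>(5)]) auto
    moreover have "k a * k t \<le> 0" "0 \<le> k a * k a" "a \<le> t" using neg t by auto
    ultimately obtain s where "a \<le> s" "s \<le> t" "k a * k s = 0" using IVT2'[of "\<lambda>s. k a * k s" t 0 a] by blast
    then show False using x[of s] x[of a] t ab by auto
  qed
  have cosn: "cos (\<kappa> * (t - a)) \<ge> 0" if t: "t \<in> {a..b}" for t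
  proof -
    have aT: "a \<in> {a..b}" using ab by simp
    have "tform (x a) (x t) \<ge> 0"
      using x[OF aT] x[OF t] convex_hull_subset_nonneg_comb by (intro tform_comb_nonneg) auto
    moreover have "tform (\<gamma> a) (\<gamma> t) = (k a * k t) * tform (x a) (x t)"
      using x[OF aT] x[OF t] by (metis mult.assoc tform_scaleR_left tform_scaleR_right)
    ultimately show ?thesis using kk[OF t] \<kappa>(3)[OF t] by simp
  qed
  define L where "L = \<kappa> * (b - a)"
  have L0: "L > 0" using \<kappa>(1) ab by (simp add: L_def)
  have "L \<le> pi / 2"
  proof (rule cos_nonneg_interval_le)
    show "L \<ge> 0" using L0 by simp
    fix s assume s: "0 \<le> s" "s \<le> L"
    have "s / \<kappa> \<le> b - a" using s(2) \<kappa>(1) by (simp add: L_def pos_divide_le_eq mult.commute)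
    then show "cos s \<ge> 0" using cosn[of "a + s / \<kappa>"] s(1) \<kappa>(1) by simp
  qed
  have bT: "b \<in> {a..b}" "a \<in> {a..b}" using ab by auto
  have "1 \<le> C * (cos L)\<^sup>2"
  proof -
    have e: "tform (\<gamma> s) (\<gamma> t) = (k s * k t) * tform (x s) (x t)" if "s \<in> {a..b}" "t \<in> {a..b}" for s t
      using x[OF that(1)] x[OF that(2)] by (metis mult.assoc tform_scaleR_left tform_scaleR_right)
    have "1 = tform (\<gamma> a) (\<gamma> a) * tform (\<gamma> b) (\<gamma> b)" using \<kappa>(4) bT by simp
    also have "\<dots> = (k a * k b)\<^sup>2 * (tform (x a) (x a) * tform (x b) (x b))"
      using bT by (simp add: e power2_eq_square)
    also have "\<dots> \<le> (k a * k b)\<^sup>2 * (C * (tform (x a) (x b))\<^sup>2)"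
      using x bT by (intro mult_left_mono hull_bound) auto
    also have "\<dots> = C * (tform (\<gamma> a) (\<gamma> b))\<^sup>2" using bT by (simp add: e power_mult_distrib)
    also have "\<dots> = C * (cos L)\<^sup>2" using \<kappa>(3)[OF bT(1)] by (simp add: L_def)
    finally show ?thesis .
  qed
  then have C1: "1 \<le> (cosh (N / 2))\<^sup>2 * (cos L)\<^sup>2" by (simp add: C_cosh)
  then have "cos L \<noteq> 0" by auto
  then have "L \<noteq> pi / 2" using cos_pi_half by metis
  with \<open>L \<le> pi / 2\<close> have L2: "L < pi / 2" by simp
  have "(tan L)\<^sup>2 = 1 / (cos L)\<^sup>2 - 1"
    using \<open>cos L \<noteq> 0\<close> tan_sec[of L] by (simp add: power_inverse inverse_eq_divide power_divide)
  also have "\<dots> \<le> (cosh (N / 2))\<^sup>2 - 1"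
    using C1 \<open>cos L \<noteq> 0\<close> by (simp add: pos_divide_le_eq)
  also have "\<dots> = (sinh (N / 2))\<^sup>2" by (simp add: sinh_square_eq)
  finally have "tan L \<le> sinh (N / 2)"
    by (rule power2_le_imp_le) (use N(2) in simp)
  then have "arctan (tan L) \<le> arctan (sinh (N / 2))" by (simp add: arctan_le_iff)
  then have "L \<le> arctan (sinh (N / 2))" using L0 L2 by (simp add: arctan_tan)
  then show ?thesis using \<kappa>(2) by (simp add: L_def)
qed

theorem proposition1:
  fixes \<phi> :: "rp1 \<Rightarrow> rp1" and w :: ereal
  assumes "quasisymmetric \<phi>"
    and "w = width (gr \<phi>)"
  shows "w < ereal (pi / 2) \<and> tan (real_of_ereal w) \<le> sinh (real_of_ereal (cr_norm \<phi>) / 2)"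
proof -
  obtain N where N: "cr_norm \<phi> = ereal N" "N \<ge> 0"
    "\<And>z1 z2 z3 z4. cr z1 z2 z3 z4 = -1 \<Longrightarrow> \<bar>ln \<bar>cr (\<phi> z1) (\<phi> z2) (\<phi> z3) (\<phi> z4)\<bar>\<bar> \<le> N"
    using cr_norm_bounds[OF assms(1)] by metis
  define A where "A = arctan (sinh (N / 2))"
  have A: "0 \<le> A" "A < pi / 2" "tan A = sinh (N / 2)"
    using N(2) arctan_bounded[of "sinh (N / 2)"] by (simp_all add: A_def tan_arctan)
  have "w \<le> ereal A"
    unfolding assms(2) width_def
  proof (rule Sup_least)
    fix l assume "l \<in> insert 0 {ereal (timelike_length a b \<gamma>) | a b \<gamma>.
        timelike_geodesic_segment a b \<gamma> \<and> (\<forall>t\<in>{a..b}. proj (\<gamma> t) \<in> CH (gr \<phi>))}"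
    then show "l \<le> ereal A"
      using timelike_length_le[OF assms(1) N] A(1) by (auto simp: A_def zero_ereal_def)
  qed
  moreover have "0 \<le> w" unfolding assms(2) width_def by (rule Sup_upper) simp
  ultimately obtain v where v: "w = ereal v" "0 \<le> v" "v \<le> A" by (cases w) auto
  have "tan v \<le> tan A" using v A by (intro tan_mono_le) auto
  then show ?thesis using v A N(1) by simp
qed

end
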